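(* Let $J\subseteq\mathbb{Z}^n$ be a jump system and $H\subseteq\mathbb{Z}^n$ a sponge. Then $x\in J$ is not $H$-optimal in $J$ if and only if there exists $y\in J$ whose distance from the environment $H_x$, or from at least one of the (at most $2n$) escapes $H_{x,\underline{i}},\ H_{x,\overline{i}}$ $(i\in[n])$ from $H_x$, is smaller than $\mu(x,H)$; that is, $\mu(y,K)<\mu(x,H)$ for some $K$ among $H_x$ and the defined escapes from $H_x$. Moreover, an $H$-optimal element of $J$ can be found by solving $(2n+1)n$ parity sponge deficiency problems for $J$.
   Context: Notation: $[n]=\{1,\dots,n\}$ and $e_i$ is the $i$-th unit vector. For $x,y\in\mathbb{Z}^n$, $\mu(x,y)=\sum_{i=1}^n|x(i)-y(i)|$. For sets, $\mu(X,Y)=\min_{x\in X,y\in Y}\mu(x,y)$, and $\mu(x,Y)=\mu(\{x\},Y)$. Steps and jump systems: A step from $x\in\mathbb{Z}^n$ at $i\in[n]$ is a vector $x'\in\mathbb{Z}^n$ with $x'-x=\pm e_i$. It is a step towards a set $S$ (or towards a point $y$, with $S=\{y\}$) if $\mu(x',S)<\mu(x,S)$. A jump system is a nonempty set $J\subseteq\mathbb{Z}^n$ such that for all $x,y\in J$ and every step $x'$ from $x$ towards $y$, either $x'\in J$ or there is a step $x''$ from $x'$ towards $y$ with $x''\in J$. Sponges: A nonempty set $K\subseteq\mathbb{Z}$ is a one-dimensional sponge if, whenever $a,b\in K$, $a<i<b$ and $i\notin K$, we have $i-1,i+1\in K$. A sponge $H\subseteq\mathbb{Z}^n$ is a Cartesian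 product of one-dimensional sponges $H(1),\dots,H(n)$. The entrywise minima $l(i)=\min H(i)$ and maxima $u(i)=\max H(i)$ are assumed to exist. A parity sponge is a sponge $H$ such that each $H(i)$ consists of every second integer between its minimum and its maximum, both included (so the minimum and maximum have the same parity; a singleton is allowed). Optimality: For a sponge $H$, an element $z\in J$ is $H$-optimal if $\mu(z,H)=\mu(J,H)$. Solving a parity sponge deficiency problem for $J$ means: given a parity sponge $P\subseteq\mathbb{Z}^n$, one oracle call returns $\mu(J,P)$ and a $P$-optimal $z\in J$. The last assertion counts the calls to this oracle; $H$ is given explicitly, and the number of other operations is negligible. Environment and escapes: For a one-dimensional sponge $K\subseteq\mathbb{Z}$ and $z\in\mathbb{Z}$, define $l_z=\min\{h\in K:\text{all integers in }K\cap[h,z]\text{ have the same parity}\}$ and $u_z=\max\{h\in K:\text{all integers in }K\cap[z,h]\text{ have the same parity}\}$ (the condition holds vacuously when the intersection is empty). The environment of $z$ in $K$ is $K_z=K\cap[l_z,u_z]$. The lower escape value is $l_z-1$, defined only if $l_z-1\in K$; the upper escape value is $u_z+1$, defined only if $u_z+1\in K$. For a sponge $H\subseteq\mathbb{Z}^n$ and $z\in\mathbb{Z}^n$, the environment $H_z$ is the Cartesian product of the sets $H(i)_{z(i)}$, $i\in[n]$. For each $i\in[n]$, the lower escape $H_{z,\underline{i}}$ (respectively the upper escape $H_{z,\overline{i}}$) is obtained from the product $H_z$ by replacing its $i$-th factor by the singleton consisting of the lower (respectively upper) escape value of $z(i)$ in $H(i)$; it is undefined if that escape value is undefined. *)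

theory Defs
  imports "HOL-Analysis.Finite_Cartesian_Product"
begin

text \<open>
  Integer vectors are elements of \<^typ>\<open>int ^ 'n\<close>, so the dimension is \<open>CARD('n)\<close>.
\<close>

definition mu :: "int ^ 'n \<Rightarrow> int ^ 'n \<Rightarrow> nat" where
  "mu x y = (\<Sum>i\<in>UNIV. nat \<bar>x $ i - y $ i\<bar>)"

text \<open>For nonempty sets this infimum of natural numbers is attained.\<close>

definition mu_sets :: "(int ^ 'n) set \<Rightarrow> (int ^ 'n) set \<Rightarrow> nat" where
  "mu_sets X Y = Inf {mu x y | x y. x \<in> X \<and> y \<in> Y}"

definition mu_pt :: "int ^ 'n \<Rightarrow> (int ^ 'n) set \<Rightarrow> nat" where
  "mu_pt x Y = mu_sets {x} Y"

definition is_step :: "int ^ 'n \<Rightarrow> 'n \<Rightarrow> int ^ 'n \<Rightarrow> bool" where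
  "is_step x i x' \<longleftrightarrow> x' - x = axis i 1 \<or> x' - x = - axis i 1"

definition step_towards :: "int ^ 'n \<Rightarrow> (int ^ 'n) set \<Rightarrow> int ^ 'n \<Rightarrow> bool" where
  "step_towards x S x' \<longleftrightarrow> (\<exists>i. is_step x i x') \<and> mu_pt x' S < mu_pt x S"

definition jump_system :: "(int ^ 'n) set \<Rightarrow> bool" where
  "jump_system J \<longleftrightarrow> J \<noteq> {} \<and>
     (\<forall>x\<in>J. \<forall>y\<in>J. \<forall>x'. step_towards x {y} x' \<longrightarrow>
        x' \<in> J \<or> (\<exists>x''. step_towards x' {y} x'' \<and> x'' \<in> J))"

definition sponge1 :: "int set \<Rightarrow> bool" where
  "sponge1 K \<longleftrightarrow> K \<noteq> {} \<and>
     (\<forall>a b i. a \<in> K \<and> b \<in> K \<and> a < i \<and> i < b \<and> i \<notin> K \<longrightarrow> i - 1 \<in> K \<and> i + 1 \<in> K)"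

definition cart_prod :: "('n \<Rightarrow> int set) \<Rightarrow> (int ^ 'n) set" where
  "cart_prod F = {x. \<forall>i. x $ i \<in> F i}"

text \<open>
  The last two conjuncts are the standing assumption that the entrywise minima and maxima exist.
\<close>

definition sponge :: "(int ^ 'n) set \<Rightarrow> bool" where
  "sponge H \<longleftrightarrow> (\<exists>F. H = cart_prod F \<and>
     (\<forall>i. sponge1 (F i) \<and> (\<exists>l\<in>F i. \<forall>h\<in>F i. l \<le> h) \<and> (\<exists>u\<in>F i. \<forall>h\<in>F i. h \<le> u)))"

text \<open>
  The \<open>i\<close>-th factor \<open>H(i)\<close> of a nonempty product \<open>H\<close> is recovered as its projection.
\<close>

definition factor :: "(int ^ 'n) set \<Rightarrow> 'n \<Rightarrow> int set" where
  "factor H i = (\<lambda>x. x $ i) ` H"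

lemma factor_cart_prod:
  assumes "\<And>j. F j \<noteq> {}"
  shows "factor (cart_prod F) i = F i"
proof
  show "factor (cart_prod F) i \<subseteq> F i"
    by (auto simp: factor_def cart_prod_def)
  show "F i \<subseteq> factor (cart_prod F) i"
  proof
    fix v assume v: "v \<in> F i"
    let ?x = "\<chi> j. if j = i then v else (SOME w. w \<in> F j)"
    have "?x \<in> cart_prod F"
      using v assms by (auto simp: cart_prod_def some_in_eq)
    moreover have "v = ?x $ i" by simp
    ultimately show "v \<in> factor (cart_prod F) i"
      unfolding factor_def by (rule rev_image_eqI)
  qed
qed

definition parity_sponge :: "(int ^ 'n) set \<Rightarrow> bool" where
  "parity_sponge P \<longleftrightarrow> sponge P \<and>
     (\<forall>i. \<exists>l u. l \<le> u \<and> even (u - l) \<and> factor P i = {h. l \<le> h \<and> h \<le> u \<and> even (h - l)})"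

definition optimal :: "(int ^ 'n) set \<Rightarrow> (int ^ 'n) set \<Rightarrow> int ^ 'n \<Rightarrow> bool" where
  "optimal J H z \<longleftrightarrow> z \<in> J \<and> mu_pt z H = mu_sets J H"

definition same_parity :: "int set \<Rightarrow> bool" where
  "same_parity A \<longleftrightarrow> (\<forall>a\<in>A. \<forall>b\<in>A. even a \<longleftrightarrow> even b)"

definition lower_end :: "int set \<Rightarrow> int \<Rightarrow> int" where
  "lower_end K z = Min {h \<in> K. same_parity (K \<inter> {h..z})}"

definition upper_end :: "int set \<Rightarrow> int \<Rightarrow> int" where
  "upper_end K z = Max {h \<in> K. same_parity (K \<inter> {z..h})}"

definition environment1 :: "int set \<Rightarrow> int \<Rightarrow> int set" where
  "environment1 K z = K \<inter> {lower_end K z..upper_end K z}"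

definition lower_escape_value :: "int set \<Rightarrow> int \<Rightarrow> int option" where
  "lower_escape_value K z =
     (if lower_end K z - 1 \<in> K then Some (lower_end K z - 1) else None)"

definition upper_escape_value :: "int set \<Rightarrow> int \<Rightarrow> int option" where
  "upper_escape_value K z =
     (if upper_end K z + 1 \<in> K then Some (upper_end K z + 1) else None)"

definition environment :: "(int ^ 'n) set \<Rightarrow> int ^ 'n \<Rightarrow> (int ^ 'n) set" where
  "environment H z = cart_prod (\<lambda>j. environment1 (factor H j) (z $ j))"

definition lower_escape :: "(int ^ 'n) set \<Rightarrow> int ^ 'n \<Rightarrow> 'n \<Rightarrow> (int ^ 'n) set option" where
  "lower_escape H z i = map_option
     (\<lambda>v. cart_prod ((\<lambda>j. environment1 (factor H j) (z $ j))(i := {v})))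
     (lower_escape_value (factor H i) (z $ i))"

definition upper_escape :: "(int ^ 'n) set \<Rightarrow> int ^ 'n \<Rightarrow> 'n \<Rightarrow> (int ^ 'n) set option" where
  "upper_escape H z i = map_option
     (\<lambda>v. cart_prod ((\<lambda>j. environment1 (factor H j) (z $ j))(i := {v})))
     (upper_escape_value (factor H i) (z $ i))"

text \<open>
  An adaptive query procedure: each query may depend on all answers received so far, and the
  computation between two queries is unrestricted and not counted. A procedure that has to work for
  every \<open>J\<close> learns about \<open>J\<close> only through the answers.
\<close>

datatype ('q, 'a, 'r) procedure =
    Return 'r
  | Ask 'q "'a \<Rightarrow> ('q, 'a, 'r) procedure"

primrec run :: "('q \<Rightarrow> 'a) \<Rightarrow> ('q, 'a, 'r) procedure \<Rightarrow> 'r" where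
  "run ans (Return r) = r"
| "run ans (Ask q k) = run ans (k (ans q))"

primrec queries :: "('q \<Rightarrow> 'a) \<Rightarrow> ('q, 'a, 'r) procedure \<Rightarrow> 'q list" where
  "queries ans (Return r) = []"
| "queries ans (Ask q k) = q # queries ans (k (ans q))"

text \<open>
  Answers to parity sponge deficiency problems for \<open>J\<close>; which of the optimal elements is returned
  is up to the solver, and nothing is assumed about its answer if \<open>P\<close> is not a parity sponge.
\<close>

definition deficiency_solver ::
    "(int ^ 'n) set \<Rightarrow> ((int ^ 'n) set \<Rightarrow> nat \<times> (int ^ 'n)) \<Rightarrow> bool" where
  "deficiency_solver J ans \<longleftrightarrow>
     (\<forall>P. parity_sponge P \<longrightarrow> fst (ans P) = mu_sets J P \<and> optimal J P (snd (ans P)))"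

end

theory Submission
  imports Defs
begin

text \<open>
  Walk from \<open>x\<close> towards a better \<open>y\<close> in \<open>J\<close>, always beginning with a step that decreases the distance
  from \<open>H\<close>. If that step leaves \<open>J\<close>, a second one returns to \<open>J\<close>. A step between two points that are
  not both in the factor of \<open>H\<close> changes the distance by one and keeps the environment, and a step
  between two points of the factor enters an escape. So either an improvement is reached in the
  environment or in an escape, or distance and environment are unchanged and the walk goes on.

  For the procedure, start with the product of the even classes of the intervals spanned by the
  factors and replace one class after the other by the true factor. Comparing with the odd class
  first makes sure that one replacement raises the optimal distance by at most one, so that a single
  round of queries suffices for it. As an optimal \<open>x\<close> is known beforehand, only the replaced
  coordinates have escapes and one of the possible queries can be left out. This costs \<open>(n + 1)\<^sup>2\<close>
  queries, which is within the bound for \<open>n \<ge> 2\<close>. For \<open>n = 1\<close>, starting from the leftmost section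
  saves one query.
\<close>

section \<open>One-dimensional distances\<close>

text \<open>Everything about one coordinate rests on gaps having width one. If the distance failed
  to change along a step not joining two members, or failed to decrease towards a nearer point, two
  adjacent integers would be missing between members. If \<open>y\<close> has the smaller total
  distance, it is nearer in some coordinate, and that one supplies the first step.

  The criterion certifies an improvement but not its size, so iterating it does not bound the number
  of queries. The procedure therefore always works from a point within one of a proven lower bound,
  where every improvement is optimal. Passing from a parity class to the true factor costs at most
  one because a class element missing from the factor has a neighbour in it.

  With \<open>k\<close> factors already true, a replacement takes one comparison query; the
  environment and two escapes in each of \<open>k + 1\<close> coordinates would add
  \<open>2 * k + 3\<close>, and one of these is left out. The numbers \<open>2 * k + 3\<close>
  together with the initial query sum to a square. For \<open>n = 1\<close> that square is 4, while
  the bound is 3.\<close>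

definition dist1 :: "int set \<Rightarrow> int \<Rightarrow> nat" where
  "dist1 K z = Inf ((\<lambda>h. nat \<bar>z - h\<bar>) ` K)"

lemma dist1_le: "h \<in> K \<Longrightarrow> dist1 K z \<le> nat \<bar>z - h\<bar>"
  unfolding dist1_def by (rule cInf_lower) auto

lemma dist1_attained:
  assumes "K \<noteq> {}"
  obtains h where "h \<in> K" "dist1 K z = nat \<bar>z - h\<bar>"
  using Inf_nat_def1[of "(\<lambda>h. nat \<bar>z - h\<bar>) ` K"] assms unfolding dist1_def by auto

lemma dist1_eq_0_iff: "K \<noteq> {} \<Longrightarrow> dist1 K z = 0 \<longleftrightarrow> z \<in> K"
  using dist1_le[of z K z] by (auto elim!: dist1_attained[of K z])

lemma dist1_antimono: "A \<subseteq> B \<Longrightarrow> A \<noteq> {} \<Longrightarrow> dist1 B z \<le> dist1 A z"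
  by (metis dist1_attained dist1_le subsetD)

lemma dist1_uminus: "dist1 (uminus ` K) (- z) = dist1 K z"
proof -
  have "(\<lambda>h. nat \<bar>- z - h\<bar>) ` uminus ` K = (\<lambda>h. nat \<bar>z - h\<bar>) ` K"
    unfolding image_image by (rule image_cong) auto
  then show ?thesis unfolding dist1_def by simp
qed

section \<open>Distances from products\<close>

lemma mu_pt_cart_prod:
  fixes x :: "int ^ 'n"
  assumes "\<And>k. F k \<noteq> {}"
  shows "mu_pt x (cart_prod F) = (\<Sum>k\<in>UNIV. dist1 (F k) (x $ k))"
  unfolding mu_pt_def mu_sets_def
proof (rule cInf_eq_minimum)
  have "\<exists>h. h \<in> F k \<and> dist1 (F k) (x $ k) = nat \<bar>x $ k - h\<bar>" for k
    using dist1_attained[OF assms] by metis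
  then obtain h where h: "\<And>k. h k \<in> F k" "\<And>k. dist1 (F k) (x $ k) = nat \<bar>x $ k - h k\<bar>"
    by metis
  have "(\<chi> k. h k) \<in> cart_prod F" by (simp add: cart_prod_def h(1))
  moreover have "mu x (\<chi> k. h k) = (\<Sum>k\<in>UNIV. dist1 (F k) (x $ k))"
    by (simp add: mu_def h(2))
  ultimately show "(\<Sum>k\<in>UNIV. dist1 (F k) (x $ k)) \<in> {mu x' y |x' y. x' \<in> {x} \<and> y \<in> cart_prod F}"
    by force
next
  fix m assume "m \<in> {mu x' y |x' y. x' \<in> {x} \<and> y \<in> cart_prod F}"
  then obtain y where "m = mu x y" "y \<in> cart_prod F" by auto
  then show "(\<Sum>k\<in>UNIV. dist1 (F k) (x $ k)) \<le> m"
    by (auto simp: mu_def cart_prod_def intro!: sum_mono dist1_le)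
qed

lemma cart_prod_nonempty: "(\<And>k. F k \<noteq> {}) \<Longrightarrow> cart_prod F \<noteq> {}"
proof -
  assume "\<And>k. F k \<noteq> {}"
  then have "(\<chi> k. SOME h. h \<in> F k) \<in> cart_prod F"
    by (simp add: cart_prod_def some_in_eq)
  then show ?thesis by blast
qed

lemma mu_pt_attained:
  assumes "H \<noteq> {}"
  obtains h where "h \<in> H" "mu_pt x H = mu x h"
  using Inf_nat_def1[of "{mu x' y |x' y. x' \<in> {x} \<and> y \<in> H}"] assms
  unfolding mu_pt_def mu_sets_def by fastforce

lemma mu_pt_le: "h \<in> H \<Longrightarrow> mu_pt x H \<le> mu x h"
  unfolding mu_pt_def mu_sets_def by (rule cInf_lower) auto

lemma mu_pt_antimono: "A \<subseteq> B \<Longrightarrow> A \<noteq> {} \<Longrightarrow> mu_pt x B \<le> mu_pt x A"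
  by (metis mu_pt_attained mu_pt_le subsetD)

lemma mu_pt_singleton [simp]: "mu_pt x {y} = mu x y"
  by (rule mu_pt_attained[of "{y}" x]) auto

lemma mu_sets_le: "y \<in> J \<Longrightarrow> H \<noteq> {} \<Longrightarrow> mu_sets J H \<le> mu_pt y H"
proof (rule mu_pt_attained[of H y])
  fix h assume "y \<in> J" "h \<in> H" "mu_pt y H = mu y h"
  then show ?thesis unfolding mu_sets_def by (auto intro!: cInf_lower)
qed

lemma mu_sets_attained:
  assumes "J \<noteq> {}" "H \<noteq> {}"
  obtains y where "y \<in> J" "mu_sets J H = mu_pt y H"
proof -
  have "mu_sets J H \<in> {mu x y |x y. x \<in> J \<and> y \<in> H}"
    unfolding mu_sets_def by (rule Inf_nat_def1) (use assms in blast)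
  then obtain y h where "y \<in> J" "h \<in> H" "mu_sets J H = mu y h" by blast
  with mu_pt_le[of h H y] mu_sets_le[of y J H] that show ?thesis
    by (metis assms(2) le_antisym)
qed

lemma optimal_iff:
  assumes "H \<noteq> {}"
  shows "optimal J H z \<longleftrightarrow> z \<in> J \<and> (\<forall>y\<in>J. mu_pt z H \<le> mu_pt y H)"
proof
  show "optimal J H z \<Longrightarrow> z \<in> J \<and> (\<forall>y\<in>J. mu_pt z H \<le> mu_pt y H)"
    using mu_sets_le[OF _ assms] by (auto simp: optimal_def)
  assume z: "z \<in> J \<and> (\<forall>y\<in>J. mu_pt z H \<le> mu_pt y H)"
  then have "J \<noteq> {}" by auto
  from mu_sets_attained[OF this assms] obtain y where "y \<in> J" "mu_sets J H = mu_pt y H" .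
  with z mu_sets_le[of z J H] assms show "optimal J H z"
    by (auto simp: optimal_def intro: le_antisym)
qed

section \<open>Descent along a jump system\<close>

text \<open>\<open>R\<close> is the region in which the walk goes on and \<open>X\<close> the points
  where it may end. \<open>d\<close> stays abstract because the walk is also run with a distance
  altered at the target \<open>b\<close>. The last conjunct makes a coordinate that is worse than
  its target a safe choice for the first step.\<close>

definition descent :: "(int \<Rightarrow> nat) \<Rightarrow> int set \<Rightarrow> int set \<Rightarrow> int \<Rightarrow> bool" where
  "descent d R X b \<longleftrightarrow> (\<forall>t\<in>R. \<forall>s. t \<noteq> b \<and> s = t + sgn (b - t) \<longrightarrow>
     (s \<in> R \<and> (d s = d t + 1 \<or> d t = d s + 1) \<or> s \<in> X \<and> d s = d t) \<and>
     (d b < d t \<longrightarrow> s \<in> R \<and> d t = d s + 1))"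

lemma descentD:
  assumes "descent d R X b" "t \<in> R" "t \<noteq> b"
  shows "t + sgn (b - t) \<in> R \<and> (d (t + sgn (b - t)) = d t + 1 \<or> d t = d (t + sgn (b - t)) + 1)
      \<or> t + sgn (b - t) \<in> X \<and> d (t + sgn (b - t)) = d t"
    and "d b < d t \<Longrightarrow> t + sgn (b - t) \<in> R \<and> d t = d (t + sgn (b - t)) + 1"
  using assms unfolding descent_def by blast+

text \<open>Written with additions on both sides because subtraction of naturals truncates.\<close>

lemma sum_axis_step:
  fixes x :: "int ^ 'n"
  shows "(\<Sum>k\<in>UNIV. d k ((x + axis j c) $ k)) + d j (x $ j)
    = (\<Sum>k\<in>UNIV. d k (x $ k)) + (d j (x $ j + c) :: nat)"
proof -
  have "(\<Sum>k\<in>UNIV-{j}. d k ((x + axis j c) $ k)) = (\<Sum>k\<in>UNIV-{j}. d k (x $ k))"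
    by (rule sum.cong) (auto simp: axis_def)
  then show ?thesis
    using sum.remove[of UNIV j "\<lambda>k. d k ((x + axis j c) $ k)"]
      sum.remove[of UNIV j "\<lambda>k. d k (x $ k)"]
    by (simp add: axis_def)
qed

lemma mu_axis_step:
  assumes "x $ j \<noteq> y $ j"
  shows "mu (x + axis j (sgn (y $ j - x $ j))) y + 1 = mu x y"
proof -
  have "nat \<bar>x $ j - y $ j\<bar> = nat \<bar>x $ j + sgn (y $ j - x $ j) - y $ j\<bar> + 1"
    using assms by (auto simp: sgn_if)
  with sum_axis_step[of "\<lambda>k t. nat \<bar>t - y $ k\<bar>" x j "sgn (y $ j - x $ j)"]
  show ?thesis by (simp add: mu_def)
qed

lemma step_towards_iff:
  fixes x y x' :: "int ^ 'n"
  shows "step_towards x {y} x' \<longleftrightarrow> (\<exists>j. x $ j \<noteq> y $ j \<and> x' = x + axis j (sgn (y $ j - x $ j)))"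
proof
  assume "step_towards x {y} x'"
  then obtain j where j: "x' - x = axis j 1 \<or> x' - x = - axis j 1" and lt: "mu x' y < mu x y"
    by (auto simp: step_towards_def is_step_def)
  have neg: "- axis j (1::int) = (axis j (-1) :: int ^ 'n)" by (simp add: vec_eq_iff axis_def)
  obtain c :: int where c: "c = 1 \<or> c = -1" "x' = x + axis j c"
    using j neg by (metis diff_add_cancel add.commute)
  have "nat \<bar>x $ j + c - y $ j\<bar> < nat \<bar>x $ j - y $ j\<bar>"
    using sum_axis_step[of "\<lambda>k t. nat \<bar>t - y $ k\<bar>" x j c] lt unfolding c(2) mu_def
    by linarith
  with c(1) have "x $ j \<noteq> y $ j \<and> c = sgn (y $ j - x $ j)" by (auto simp: sgn_if)
  with c(2) show "\<exists>j. x $ j \<noteq> y $ j \<and> x' = x + axis j (sgn (y $ j - x $ j))" by blast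
next
  assume "\<exists>j. x $ j \<noteq> y $ j \<and> x' = x + axis j (sgn (y $ j - x $ j))"
  then obtain j where j: "x $ j \<noteq> y $ j" "x' = x + axis j (sgn (y $ j - x $ j))" by blast
  have "x' - x = axis j 1 \<or> x' - x = - axis j 1"
    using j by (auto simp: vec_eq_iff axis_def sgn_if)
  with mu_axis_step[OF j(1)] j(2) show "step_towards x {y} x'"
    by (auto simp: step_towards_def is_step_def)
qed

text \<open>
  A decreasing step of \<open>x\<close> that leads out of \<open>J\<close> is completed by a second step. Unless this makes
  \<open>x\<close> better, it restores the distance and keeps every coordinate in its region, so the argument
  can be repeated closer to \<open>y\<close>.
\<close>

lemma jump_system_descent:
  fixes x y :: "int ^ 'n"
  assumes J: "jump_system J" and y: "y \<in> J"
    and desc: "\<And>k. descent (d k) (R k) (X k) (y $ k)"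
    and "x \<in> J" "\<And>k. x $ k \<in> R k"
    and "(\<Sum>k\<in>UNIV. d k (y $ k)) < (\<Sum>k\<in>UNIV. d k (x $ k))"
  obtains w where "w \<in> J" "(\<Sum>k\<in>UNIV. d k (w $ k)) < (\<Sum>k\<in>UNIV. d k (x $ k))"
    "(\<forall>k. w $ k \<in> R k) \<or> (\<exists>i. w $ i \<in> X i \<and> (\<forall>k. k \<noteq> i \<longrightarrow> w $ k \<in> R k))"
proof -
  have "\<exists>w\<in>J. (\<Sum>k\<in>UNIV. d k (w $ k)) < (\<Sum>k\<in>UNIV. d k (x $ k)) \<and>
    ((\<forall>k. w $ k \<in> R k) \<or> (\<exists>i. w $ i \<in> X i \<and> (\<forall>k. k \<noteq> i \<longrightarrow> w $ k \<in> R k)))"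
    using assms(4-6)
  proof (induction "mu x y" arbitrary: x rule: less_induct)
    case less
    let ?d = "\<lambda>x. \<Sum>k\<in>UNIV. d k (x $ k)"
    have "\<exists>j. d j (y $ j) < d j (x $ j)"
    proof (rule ccontr)
      assume "\<not> (\<exists>j. d j (y $ j) < d j (x $ j))"
      then have "?d x \<le> ?d y" by (intro sum_mono) (meson not_less)
      with less.prems(3) show False by simp
    qed
    then obtain j where j: "d j (y $ j) < d j (x $ j)" by blast
    then have nej: "x $ j \<noteq> y $ j" by auto
    define x' where "x' = x + axis j (sgn (y $ j - x $ j))"
    have dj: "x $ j + sgn (y $ j - x $ j) \<in> R j"
        "d j (x $ j) = d j (x $ j + sgn (y $ j - x $ j)) + 1"
      using descentD(2)[OF desc less.prems(2) nej j] by auto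
    have R': "x' $ k \<in> R k" for k
      using dj(1) less.prems(2)[of k] by (cases "k = j") (auto simp: x'_def axis_def)
    have d': "?d x = ?d x' + 1"
      using sum_axis_step[of d x j "sgn (y $ j - x $ j)"] dj(2) by (simp add: x'_def)
    have "step_towards x {y} x'" unfolding step_towards_iff x'_def using nej by blast
    then consider "x' \<in> J" | x'' where "step_towards x' {y} x''" "x'' \<in> J"
      using J y less.prems(1) unfolding jump_system_def by blast
    then show ?case
    proof cases
      case 1
      with R' d' show ?thesis by (intro bexI[of _ x']) auto
    next
      case 2
      then obtain k where nek: "x' $ k \<noteq> y $ k" and x'': "x'' = x' + axis k (sgn (y $ k - x' $ k))"
        unfolding step_towards_iff by blast
      let ?s = "x' $ k + sgn (y $ k - x' $ k)"
      have mu: "mu x'' y < mu x y"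
        using mu_axis_step[OF nek] mu_axis_step[OF nej] by (simp add: x'' x'_def)
      have s: "x'' $ k = ?s" "\<And>m. m \<noteq> k \<Longrightarrow> x'' $ m = x' $ m" by (auto simp: x'' axis_def)
      have d'': "?d x'' + d k (x' $ k) = ?d x' + d k ?s"
        unfolding x'' by (rule sum_axis_step)
      have R'': "x'' $ m \<in> R m" if "?s \<in> R k" for m
        using that R' s by (cases "m = k") auto
      from descentD(1)[OF desc R' nek]
      consider "?s \<in> R k" "d k ?s = d k (x' $ k) + 1" | "?s \<in> R k" "d k (x' $ k) = d k ?s + 1"
        | "?s \<in> X k" "d k ?s = d k (x' $ k)" by blast
      then show ?thesis
      proof cases
        case 1
        with d' d'' have "?d x'' = ?d x" by simp
        with less.hyps[OF mu 2(2) R''[OF 1(1)]] less.prems(3) show ?thesis by simp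
      next
        case 2
        with d' d'' R'' \<open>x'' \<in> J\<close> show ?thesis by (intro bexI[of _ x'']) auto
      next
        case 3
        with d' d'' have "?d x'' < ?d x" by simp
        moreover have "x'' $ k \<in> X k \<and> (\<forall>m. m \<noteq> k \<longrightarrow> x'' $ m \<in> R m)" using 3 R' s by auto
        ultimately show ?thesis using \<open>x'' \<in> J\<close> by blast
      qed
    qed
  qed
  with that show ?thesis by blast
qed

section \<open>One-dimensional sponges\<close>

text \<open>For a nonempty set of integers, finiteness is the same as having a minimum and a
  maximum, and it makes \<open>Min\<close> and \<open>Max\<close> meaningful.\<close>

definition finite_sponge1 :: "int set \<Rightarrow> bool" where
  "finite_sponge1 K \<longleftrightarrow> sponge1 K \<and> finite K"

lemma finite_sponge1_nonempty: "finite_sponge1 K \<Longrightarrow> K \<noteq> {}"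
  by (simp add: finite_sponge1_def sponge1_def)

lemma finite_sponge1_gap:
  assumes "finite_sponge1 K" "a \<in> K" "b \<in> K" "a < i" "i < b" "i \<notin> K"
  shows "i - 1 \<in> K" "i + 1 \<in> K"
proof -
  have "sponge1 K" using assms(1) by (simp add: finite_sponge1_def)
  then have "a \<in> K \<and> b \<in> K \<and> a < i \<and> i < b \<and> i \<notin> K \<longrightarrow> i - 1 \<in> K \<and> i + 1 \<in> K"
    unfolding sponge1_def by meson
  with assms show "i - 1 \<in> K" "i + 1 \<in> K" by simp_all
qed

section \<open>Parity, reflection and the ends of an environment\<close>

lemma same_parityD: "same_parity A \<Longrightarrow> a \<in> A \<Longrightarrow> b \<in> A \<Longrightarrow> even a \<longleftrightarrow> even b"
  unfolding same_parity_def by blast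

lemma same_parity_uminus: "same_parity (uminus ` A) = same_parity A"
  unfolding same_parity_def ball_simps(9) even_minus ..

lemma same_parity_subset: "same_parity B \<Longrightarrow> A \<subseteq> B \<Longrightarrow> same_parity A"
  unfolding same_parity_def by blast

lemma same_parity_subset_singleton: "A \<subseteq> {a} \<Longrightarrow> same_parity A"
  by (rule same_parity_subset[of "{a}"]) (simp_all add: same_parity_def)

lemma mem_uminus_image: "t \<in> uminus ` K \<longleftrightarrow> - t \<in> K" for t :: int
proof
  assume "- t \<in> K"
  then have "- (- t) \<in> uminus ` K" by (rule imageI)
  then show "t \<in> uminus ` K" by simp
qed auto

lemma uminus_image_Int_atLeastAtMost:
  "uminus ` K \<inter> {- z..- h} = uminus ` (K \<inter> {h..z})" for z h :: int
  by (rule set_eqI) (simp only: Int_iff mem_uminus_image atLeastAtMost_iff, linarith)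

lemma finite_sponge1_uminus:
  assumes "finite_sponge1 K"
  shows "finite_sponge1 (uminus ` K)"
  unfolding finite_sponge1_def sponge1_def
proof (intro conjI allI impI)
  show "uminus ` K \<noteq> {}" using finite_sponge1_nonempty[OF assms] by simp
  show "finite (uminus ` K)" using assms by (simp add: finite_sponge1_def)
next
  fix a b i
  assume *: "a \<in> uminus ` K \<and> b \<in> uminus ` K \<and> a < i \<and> i < b \<and> i \<notin> uminus ` K"
  then have "- b \<in> K" "- a \<in> K" "- b < - i" "- i < - a" "- i \<notin> K"
    by (simp_all add: mem_uminus_image)
  note gap = finite_sponge1_gap[OF assms this]
  have "- (i - 1) = - i + 1" "- (i + 1) = - i - 1" by linarith+
  with gap show "i - 1 \<in> uminus ` K" "i + 1 \<in> uminus ` K"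
    by (simp_all only: mem_uminus_image)
qed

text \<open>An element other than \<open>h\<close> between \<open>z\<close> and \<open>h\<close>,
  \<open>z\<close> itself included, would be nearer to \<open>z\<close>.\<close>

lemma dist1_outside_nearest:
  assumes "h \<in> K" "dist1 K z = nat \<bar>z - h\<bar>"
  shows "K \<inter> {h..z} \<subseteq> {h}" "K \<inter> {z..h} \<subseteq> {h}"
proof -
  have "t = h" if "t \<in> K" "h \<le> t \<and> t \<le> z \<or> z \<le> t \<and> t \<le> h" for t
    using dist1_le[OF that(1), of z] assms(2) that(2) by linarith
  then show "K \<inter> {h..z} \<subseteq> {h}" "K \<inter> {z..h} \<subseteq> {h}" by auto
qed

text \<open>The candidate set of the maximum is never empty: it contains a nearest element of
  \<open>K\<close>, on whichever side of \<open>z\<close> that lies, since the interval in question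
  then meets \<open>K\<close> in at most one point.\<close>

lemma upper_end_props:
  assumes "finite_sponge1 K"
  shows "upper_end K z \<in> K" "same_parity (K \<inter> {z..upper_end K z})"
proof -
  obtain h where h: "h \<in> K" "dist1 K z = nat \<bar>z - h\<bar>"
    using dist1_attained finite_sponge1_nonempty[OF assms] by blast
  then have "h \<in> {h \<in> K. same_parity (K \<inter> {z..h})}"
    using same_parity_subset_singleton[OF dist1_outside_nearest(2)[OF h]] by simp
  then have "upper_end K z \<in> {h \<in> K. same_parity (K \<inter> {z..h})}"
    unfolding upper_end_def using assms by (intro Max_in) (auto simp: finite_sponge1_def)
  then show "upper_end K z \<in> K" "same_parity (K \<inter> {z..upper_end K z})" by auto
qed

lemma upper_end_ge:
  assumes "finite_sponge1 K" "h \<in> K" "same_parity (K \<inter> {z..h})"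
  shows "h \<le> upper_end K z"
  unfolding upper_end_def using assms by (intro Max_ge) (auto simp: finite_sponge1_def)

text \<open>Reflection at 0 exchanges the two ends, so facts about lower ends are derived from those
  about upper ends.\<close>

lemma lower_end_uminus:
  assumes K: "finite_sponge1 K"
  shows "lower_end K z = - upper_end (uminus ` K) (- z)"
  unfolding lower_end_def
proof (rule Min_eqI)
  let ?u = "upper_end (uminus ` K) (- z)"
  have eq: "same_parity (uminus ` K \<inter> {- z..- h}) = same_parity (K \<inter> {h..z})" for h
    by (simp only: uminus_image_Int_atLeastAtMost same_parity_uminus)
  note U = upper_end_props[OF finite_sponge1_uminus[OF K], of "- z"]
  show "finite {h \<in> K. same_parity (K \<inter> {h..z})}" using K by (simp add: finite_sponge1_def)
  have "- ?u \<in> K" using U(1) by (simp only: mem_uminus_image)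
  moreover have "same_parity (K \<inter> {- ?u..z})" using U(2) eq[of "- ?u"] by simp
  ultimately show "- ?u \<in> {h \<in> K. same_parity (K \<inter> {h..z})}" by simp
  fix h assume "h \<in> {h \<in> K. same_parity (K \<inter> {h..z})}"
  then have "- h \<in> uminus ` K" "same_parity (uminus ` K \<inter> {- z..- h})"
    by (simp_all add: eq mem_uminus_image)
  then have "- h \<le> ?u" by (rule upper_end_ge[OF finite_sponge1_uminus[OF K]])
  then show "- ?u \<le> h" by linarith
qed

lemma lower_end_props:
  assumes "finite_sponge1 K"
  shows "lower_end K z \<in> K" "same_parity (K \<inter> {lower_end K z..z})"
proof -
  define l where "l = lower_end K z"
  have u: "upper_end (uminus ` K) (- z) = - l"
    unfolding l_def lower_end_uminus[OF assms] by (rule minus_minus[symmetric])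
  note U = upper_end_props[OF finite_sponge1_uminus[OF assms], of "- z", unfolded u]
  show "lower_end K z \<in> K" using U(1) by (simp add: l_def mem_uminus_image)
  show "same_parity (K \<inter> {lower_end K z..z})"
    using U(2) by (simp only: uminus_image_Int_atLeastAtMost same_parity_uminus l_def)
qed

lemma lower_end_le:
  assumes "finite_sponge1 K" "h \<in> K" "same_parity (K \<inter> {h..z})"
  shows "lower_end K z \<le> h"
  unfolding lower_end_def using assms by (intro Min_le) (auto simp: finite_sponge1_def)

lemma upper_end_consecutive:
  assumes "finite_sponge1 K" "z \<in> K" "z + 1 \<in> K"
  shows "upper_end K z = z"
proof (rule antisym)
  show "z \<le> upper_end K z"
    using assms by (intro upper_end_ge same_parity_subset_singleton[of _ z]) auto
  show "upper_end K z \<le> z"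
  proof (rule ccontr)
    assume "\<not> upper_end K z \<le> z"
    then have "z \<in> K \<inter> {z..upper_end K z}" "z + 1 \<in> K \<inter> {z..upper_end K z}" using assms by auto
    from same_parityD[OF upper_end_props(2)[OF assms(1)] this] show False by simp
  qed
qed

text \<open>Moving from \<open>z\<close> to \<open>z + 1\<close> drops only \<open>z\<close> from
  the interval. This can matter only if \<open>z\<close> belongs to \<open>K\<close> and
  \<open>z + 1\<close> does not; a candidate further right then forces \<open>z + 2\<close> into
  \<open>K\<close>, which carries the parity of \<open>z\<close>.\<close>

lemma upper_end_step:
  assumes K: "finite_sponge1 K" and z: "\<not> (z \<in> K \<and> z + 1 \<in> K)"
  shows "upper_end K (z + 1) = upper_end K z"
proof -
  have "same_parity (K \<inter> {z + 1..h}) \<longleftrightarrow> same_parity (K \<inter> {z..h})" if "h \<in> K" for h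
  proof (cases "z \<in> K \<and> z + 1 < h")
    case True
    then have "z + 2 \<in> K" using finite_sponge1_gap(2)[OF K, of z h "z + 1"] z that by (simp add: add.commute)
    have eq: "K \<inter> {z..h} = insert z (K \<inter> {z + 1..h})" using True by auto
    have "z + 2 \<in> K \<inter> {z + 1..h}" using True \<open>z + 2 \<in> K\<close> by auto
    then have "even z \<longleftrightarrow> even a" if "same_parity (K \<inter> {z + 1..h})" "a \<in> K \<inter> {z + 1..h}" for a
      using same_parityD[OF that(1) _ that(2), of "z + 2"] by simp
    then show ?thesis unfolding eq same_parity_def by blast
  next
    case False
    show ?thesis
    proof (cases "z \<in> K \<and> z \<le> h")
      case True
      moreover from this False z that have "h \<le> z + 1" "h \<noteq> z + 1" by auto
      ultimately have "h = z" by linarith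
      then show ?thesis by (simp add: same_parity_def)
    next
      case False
      then have "t \<in> {z + 1..h} \<longleftrightarrow> t \<in> {z..h}" if "t \<in> K" for t
        using that by (cases "t = z") auto
      then have "K \<inter> {z + 1..h} = K \<inter> {z..h}" by blast
      then show ?thesis by simp
    qed
  qed
  then have "{h \<in> K. same_parity (K \<inter> {z + 1..h})} = {h \<in> K. same_parity (K \<inter> {z..h})}"
    by (intro Collect_cong conj_cong refl)
  then show ?thesis by (simp only: upper_end_def)
qed

lemma lower_end_consecutive:
  assumes "finite_sponge1 K" "z \<in> K" "z - 1 \<in> K"
  shows "lower_end K z = z"
proof -
  have "upper_end (uminus ` K) (- z) = - z"
    by (rule upper_end_consecutive[OF finite_sponge1_uminus[OF assms(1)]])
      (use assms in \<open>simp_all add: mem_uminus_image\<close>)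
  then show ?thesis by (simp add: lower_end_uminus[OF assms(1)])
qed

lemma lower_end_step:
  assumes "finite_sponge1 K" "\<not> (z \<in> K \<and> z + 1 \<in> K)"
  shows "lower_end K (z + 1) = lower_end K z"
proof -
  have "upper_end (uminus ` K) (- z - 1 + 1) = upper_end (uminus ` K) (- z - 1)"
    by (rule upper_end_step[OF finite_sponge1_uminus[OF assms(1)]])
      (use assms in \<open>auto simp: mem_uminus_image add.commute\<close>)
  then show ?thesis by (simp add: lower_end_uminus[OF assms(1)])
qed

section \<open>Points with the same environment, and escape values\<close>

definition same_ends :: "int set \<Rightarrow> int \<Rightarrow> int set" where
  "same_ends K z = {t. lower_end K t = lower_end K z \<and> upper_end K t = upper_end K z}"

text \<open>The intersection with \<open>K\<close> encodes definedness: an undefined escape is a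
  missing element.\<close>

definition escape_values :: "int set \<Rightarrow> int \<Rightarrow> int set" where
  "escape_values K z = {lower_end K z - 1, upper_end K z + 1} \<inter> K"

lemma same_ends_refl [simp]: "z \<in> same_ends K z"
  by (simp add: same_ends_def)

lemma environment1_same_ends: "t \<in> same_ends K z \<Longrightarrow> environment1 K t = environment1 K z"
  by (simp add: same_ends_def environment1_def)

lemma same_ends_step:
  assumes "finite_sponge1 K" "t \<in> same_ends K z" "\<bar>s - t\<bar> = 1" "\<not> (t \<in> K \<and> s \<in> K)"
  shows "s \<in> same_ends K z"
proof -
  from assms(3) consider "s = t + 1" | "t = s + 1" by linarith
  then show ?thesis
    using assms(2,4) upper_end_step[OF assms(1)] lower_end_step[OF assms(1)]
    by cases (auto simp: same_ends_def)
qed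

text \<open>A member of \<open>K\<close> with a neighbour in \<open>K\<close> is an end of its own
  environment, since the two have opposite parity.\<close>

lemma escape_step:
  assumes K: "finite_sponge1 K" "t \<in> same_ends K z" "t \<in> K"
  shows "t + 1 \<in> K \<Longrightarrow> t + 1 = upper_end K z + 1" "t - 1 \<in> K \<Longrightarrow> t - 1 = lower_end K z - 1"
  using upper_end_consecutive[OF K(1,3)] lower_end_consecutive[OF K(1,3)] K(2)
  by (auto simp: same_ends_def)

lemma nearest_mem_environment1:
  assumes "finite_sponge1 K" "h \<in> K" "dist1 K z = nat \<bar>z - h\<bar>"
  shows "h \<in> environment1 K z"
  using dist1_outside_nearest[OF assms(2,3)] assms(1,2)
  by (auto simp: environment1_def intro!: upper_end_ge lower_end_le same_parity_subset_singleton)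

lemma environment1_subset: "environment1 K z \<subseteq> K"
  by (simp add: environment1_def)

lemma environment1_nonempty: "finite_sponge1 K \<Longrightarrow> environment1 K z \<noteq> {}"
  using nearest_mem_environment1 dist1_attained finite_sponge1_nonempty by (metis empty_iff)

text \<open>A nearest element of \<open>K\<close> lies in the environment, so restricting to it
  loses nothing.\<close>

lemma dist1_environment1:
  assumes "finite_sponge1 K"
  shows "dist1 (environment1 K z) z = dist1 K z"
proof (rule antisym)
  obtain h where h: "h \<in> K" "dist1 K z = nat \<bar>z - h\<bar>"
    using dist1_attained finite_sponge1_nonempty[OF assms] by blast
  then show "dist1 (environment1 K z) z \<le> dist1 K z"
    using dist1_le nearest_mem_environment1[OF assms] by metis
  show "dist1 K z \<le> dist1 (environment1 K z) z"
    by (rule dist1_antimono[OF environment1_subset environment1_nonempty[OF assms]])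
qed

text \<open>If \<open>z\<close> is in \<open>K\<close>, both halves have its parity. Otherwise
  elements on both sides make \<open>z\<close> a gap, and \<open>z - 1\<close> and
  \<open>z + 1\<close> transfer the parity from one half to the other.\<close>

lemma same_parity_environment1:
  assumes K: "finite_sponge1 K"
  shows "same_parity (environment1 K z)"
proof -
  let ?l = "lower_end K z" and ?u = "upper_end K z"
  note L = lower_end_props(2)[OF K, of z] and U = upper_end_props(2)[OF K, of z]
  have main: "even a \<longleftrightarrow> even b" if "a \<in> K" "b \<in> K" "?l \<le> a" "a < z" "z < b" "b \<le> ?u" for a b
  proof (cases "z \<in> K")
    case True
    then show ?thesis using same_parityD[OF L, of a z] same_parityD[OF U, of z b] that by auto
  next
    case False
    with finite_sponge1_gap[OF K that(1,2,4,5)] have m: "z - 1 \<in> K" "z + 1 \<in> K" by auto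
    then show ?thesis
      using same_parityD[OF L, of a "z - 1"] same_parityD[OF U, of b "z + 1"] that by auto
  qed
  show ?thesis unfolding same_parity_def
  proof (intro ballI)
    fix a b assume ab: "a \<in> environment1 K z" "b \<in> environment1 K z"
    consider "a \<le> z" "b \<le> z" | "z \<le> a" "z \<le> b" | "a < z" "z < b" | "b < z" "z < a" by linarith
    then show "even a \<longleftrightarrow> even b"
    proof cases
      case 1
      with ab show ?thesis by (intro same_parityD[OF L]) (auto simp: environment1_def)
    next
      case 2
      with ab show ?thesis by (intro same_parityD[OF U]) (auto simp: environment1_def)
    next
      case 3
      with ab show ?thesis by (intro main) (auto simp: environment1_def)
    next
      case 4
      with ab show ?thesis by (intro main[symmetric]) (auto simp: environment1_def)
    qed
  qed
qed

lemma finite_sponge1_environment1: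
  assumes K: "finite_sponge1 K"
  shows "finite_sponge1 (environment1 K z)"
proof -
  have "i - 1 \<in> environment1 K z \<and> i + 1 \<in> environment1 K z"
    if "a \<in> environment1 K z" "b \<in> environment1 K z" "a < i" "i < b" "i \<notin> environment1 K z" for a b i
    using finite_sponge1_gap[OF K, of a b i] that by (auto simp: environment1_def)
  then show ?thesis
    using environment1_nonempty[OF K] K environment1_subset[of K z]
    by (auto simp: finite_sponge1_def sponge1_def intro: finite_subset)
qed

text \<open>The critical case is a nearest element of \<open>t\<close> to the left and one of
  \<open>t + 1\<close> to the right. As gaps have width one, one of the two points then lies in
  \<open>K\<close>, and the other is at distance one.\<close>

lemma dist1_adjacent:
  assumes K: "finite_sponge1 K" and "\<not> (t \<in> K \<and> t + 1 \<in> K)"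
  shows "dist1 K (t + 1) = dist1 K t + 1 \<or> dist1 K t = dist1 K (t + 1) + 1"
proof -
  note ne = finite_sponge1_nonempty[OF K]
  define d d' where "d = int (dist1 K t)" and "d' = int (dist1 K (t + 1))"
  obtain g where "g \<in> K" "dist1 K t = nat \<bar>t - g\<bar>" using dist1_attained[OF ne] .
  then have g: "g \<in> K" "d = \<bar>t - g\<bar>" by (simp_all add: d_def)
  obtain h where "h \<in> K" "dist1 K (t + 1) = nat \<bar>t + 1 - h\<bar>" using dist1_attained[OF ne] .
  then have h: "h \<in> K" "d' = \<bar>t + 1 - h\<bar>" by (simp_all add: d'_def)
  have *: "d' \<le> \<bar>t + 1 - g\<bar>" "d \<le> \<bar>t - h\<bar>"
    using dist1_le[OF g(1), of "t + 1"] dist1_le[OF h(1), of t] unfolding d_def d'_def by linarith+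
  have "d' = d + 1 \<or> d = d' + 1"
  proof -
    consider "g \<le> t" "h \<le> t" | "g > t" "h > t" | "g \<le> t" "h > t" | "g > t" "h \<le> t" by linarith
    then show ?thesis
    proof cases
      case 3
      show ?thesis
      proof (cases "t \<in> K \<or> t + 1 \<in> K")
        case True
        then have "d = 0 \<or> d' = 0" "d \<noteq> 0 \<or> d' \<noteq> 0"
          using dist1_eq_0_iff[OF ne] assms(2) by (auto simp: d_def d'_def)
        with g h * 3 show ?thesis by linarith
      next
        case False
        with 3 g(1) h(1) have "g < t" "t < h" by (auto simp: le_less)
        with False finite_sponge1_gap(2)[OF K g(1) h(1), of t] show ?thesis by auto
      qed
    qed (use g(2) h(2) * in linarith)+
  qed
  then show ?thesis unfolding d_def d'_def by linarith
qed

lemma descent_dist1: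
  assumes K: "finite_sponge1 K"
  shows "descent (dist1 K) (same_ends K z) (escape_values K z) b"
  unfolding descent_def
proof (intro ballI allI impI)
  fix t s assume t: "t \<in> same_ends K z" and s: "t \<noteq> b \<and> s = t + sgn (b - t)"
  note ne = finite_sponge1_nonempty[OF K]
  have st: "s = t + 1 \<and> t < b \<or> s = t - 1 \<and> b < t" using s by (auto simp: sgn_if)
  show "(s \<in> same_ends K z \<and> (dist1 K s = dist1 K t + 1 \<or> dist1 K t = dist1 K s + 1) \<or>
      s \<in> escape_values K z \<and> dist1 K s = dist1 K t) \<and>
    (dist1 K b < dist1 K t \<longrightarrow> s \<in> same_ends K z \<and> dist1 K t = dist1 K s + 1)"
  proof (cases "t \<in> K \<and> s \<in> K")
    case True
    then have "dist1 K s = 0" "dist1 K t = 0" using dist1_eq_0_iff[OF ne] by auto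
    moreover have "s \<in> escape_values K z"
      using escape_step[OF K t] True st by (auto simp: escape_values_def)
    ultimately show ?thesis by simp
  next
    case False
    have se: "s \<in> same_ends K z" using same_ends_step[OF K t _ False] st by auto
    have d: "dist1 K s = dist1 K t + 1 \<or> dist1 K t = dist1 K s + 1"
      using dist1_adjacent[OF K, of t] dist1_adjacent[OF K, of s] st False by (auto simp: add.commute)
    \<comment> \<open>If the distance grew, the nearest element of \<open>t\<close> would lie behind
      it and that of \<open>b\<close> ahead of it. So \<open>t\<close> would be a gap and its
      neighbour \<open>s\<close> a member, at distance 0.\<close>
    have "dist1 K t = dist1 K s + 1" if lt: "dist1 K b < dist1 K t"
    proof (rule ccontr)
      assume "dist1 K t \<noteq> dist1 K s + 1"
      with d have ds: "dist1 K s = dist1 K t + 1" by auto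
      obtain g where g: "g \<in> K" "dist1 K t = nat \<bar>t - g\<bar>" using dist1_attained[OF ne] by blast
      obtain h where h: "h \<in> K" "dist1 K b = nat \<bar>b - h\<bar>" using dist1_attained[OF ne] by blast
      have tK: "t \<notin> K" using lt dist1_eq_0_iff[OF ne, of t] by auto
      have "dist1 K s \<noteq> 0" using ds by simp
      then have sK: "s \<notin> K" using dist1_eq_0_iff[OF ne] by auto
      have gs: "dist1 K s \<le> nat \<bar>s - g\<bar>" and ht: "dist1 K t \<le> nat \<bar>t - h\<bar>"
        using dist1_le g(1) h(1) by auto
      from st show False
      proof
        assume up: "s = t + 1 \<and> t < b"
        have "g < t" using g gs ds up tK by (cases "g = t") auto
        moreover have "t < h" using h(1) ht h(2) lt up tK by (cases "h = t") auto
        ultimately show False using finite_sponge1_gap(2)[OF K g(1) h(1) _ _ tK] sK up by auto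
      next
        assume dn: "s = t - 1 \<and> b < t"
        have "t < g" using g gs ds dn tK by (cases "g = t") auto
        moreover have "h < t" using h(1) ht h(2) lt dn tK by (cases "h = t") auto
        ultimately show False using finite_sponge1_gap(1)[OF K h(1) g(1) _ _ tK] sK dn by auto
      qed
    qed
    with se d show ?thesis by blast
  qed
qed

section \<open>Crossing between sections of opposite parity\<close>

lemma descent_uminus:
  assumes "descent d R X b"
  shows "descent (\<lambda>t. d (- t)) (uminus ` R) (uminus ` X) (- b)"
  unfolding descent_def
proof (intro ballI allI impI)
  fix t s assume t: "t \<in> uminus ` R" and s: "t \<noteq> - b \<and> s = t + sgn (- b - t)"
  have R: "- t \<in> R" using t by (simp add: mem_uminus_image)
  have ne: "- t \<noteq> b" using s by auto
  have "- t + sgn (b - (- t)) = - s" using s by (auto simp: sgn_if)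
  with descentD[OF assms R ne]
  show "(s \<in> uminus ` R \<and> (d (- s) = d (- t) + 1 \<or> d (- t) = d (- s) + 1) \<or>
      s \<in> uminus ` X \<and> d (- s) = d (- t)) \<and>
    (d (- (- b)) < d (- t) \<longrightarrow> s \<in> uminus ` R \<and> d (- t) = d (- s) + 1)"
    by (simp add: mem_uminus_image)
qed

definition escape_towards :: "int set \<Rightarrow> int \<Rightarrow> int \<Rightarrow> int" where
  "escape_towards K a b = (if a < b then upper_end K a + 1 else lower_end K a - 1)"

text \<open>The elements \<open>a + 1\<close> and \<open>b + 1\<close> have opposite parity, so the
  environment of \<open>a\<close> ends before \<open>b\<close> and its upper escape is defined. From
  \<open>a\<close> up to that end members and gaps alternate, so a positive distance drops to 0 at
  the next step; this is compatible with the value 0 forged at \<open>b\<close>.\<close>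

lemma crossing_upwards:
  assumes K: "finite_sponge1 K" and ab: "a < b" "odd (b - a)" "a \<notin> K" "b \<notin> K"
    and nb: "a - 1 \<in> K" "a + 1 \<in> K" "b - 1 \<in> K" "b + 1 \<in> K"
  obtains R where "a \<in> R" "b \<notin> R" "R \<subseteq> same_ends K a" "upper_end K a + 1 \<in> K"
    "upper_end K a + 1 \<noteq> b" "descent ((dist1 K)(b := 0)) R {upper_end K a + 1} b"
proof -
  define u where "u = upper_end K a"
  note ne = finite_sponge1_nonempty[OF K]
  have "{a..a + 1} = {a, a + 1}" by auto
  then have "a + 1 \<le> u"
    unfolding u_def using ab(3) nb(2)
    by (intro upper_end_ge[OF K] same_parity_subset_singleton[of _ "a + 1"]) auto
  have uK: "u \<in> K" and par: "same_parity (K \<inter> {a..u})" using upper_end_props[OF K] by (simp_all add: u_def)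
  have "u < b + 1"
  proof (rule ccontr)
    assume "\<not> u < b + 1"
    then have "a + 1 \<in> K \<inter> {a..u}" "b + 1 \<in> K \<inter> {a..u}" using nb ab(1) by auto
    from same_parityD[OF par this] ab(2) show False by simp
  qed
  moreover have "u \<noteq> b" using uK ab(4) by auto
  ultimately have "u < b" by simp
  \<comment> \<open>Otherwise \<open>u + 2\<close> belongs to \<open>K\<close> and would extend the
    section beyond its end.\<close>
  have u1: "u + 1 \<in> K"
  proof (rule ccontr)
    assume n: "u + 1 \<notin> K"
    have "u + 1 + 1 \<in> K"
      by (rule finite_sponge1_gap(2)[OF K uK nb(4)]) (use \<open>u < b\<close> n in auto)
    then have u2: "u + 2 \<in> K" by (simp add: add.assoc)
    have "even u \<longleftrightarrow> even t" if "t \<in> K \<inter> {a..u + 2}" for t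
    proof -
      from that n consider "t \<in> K \<inter> {a..u}" | "t = u + 2"
        by (cases "t = u + 1") (auto, force)
      then show ?thesis using same_parityD[OF par, of u t] uK \<open>a + 1 \<le> u\<close> by cases auto
    qed
    then have "same_parity (K \<inter> {a..u + 2})" unfolding same_parity_def by blast
    from upper_end_ge[OF K u2 this] show False by (simp add: u_def)
  qed
  with ab(4) \<open>u < b\<close> have ub: "u + 1 < b" by (cases "u + 1 = b") auto
  \<comment> \<open>Cutting at \<open>u\<close> keeps \<open>b\<close> out of \<open>R\<close>, so
    the forged value never occurs along the walk.\<close>
  define R where "R = same_ends K a \<inter> {a..u}"
  let ?d = "(dist1 K)(b := 0)"
  have "descent ?d R {u + 1} b"
    unfolding descent_def
  proof (intro ballI allI impI)
    fix t s assume t: "t \<in> R" and s: "t \<noteq> b \<and> s = t + sgn (b - t)"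
    have tu: "t \<le> u" "a \<le> t" "t \<in> same_ends K a" using t by (auto simp: R_def)
    have s1: "s = t + 1" using s tu ub by (auto simp: sgn_if)
    have d: "?d s = dist1 K s" "?d t = dist1 K t" "?d b = 0" using s1 tu ub by auto
    show "(s \<in> R \<and> (?d s = ?d t + 1 \<or> ?d t = ?d s + 1) \<or> s \<in> {u + 1} \<and> ?d s = ?d t) \<and>
      (?d b < ?d t \<longrightarrow> s \<in> R \<and> ?d t = ?d s + 1)"
    proof (cases "t \<in> K \<and> s \<in> K")
      case True
      then have "dist1 K s = 0" "dist1 K t = 0" using dist1_eq_0_iff[OF ne] by auto
      moreover have "s = u + 1" using escape_step(1)[OF K tu(3)] True by (simp add: s1 u_def)
      ultimately show ?thesis unfolding d by simp
    next
      case False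
      then have "t \<noteq> u" using uK u1 s1 by auto
      moreover have "s \<in> same_ends K a" using same_ends_step[OF K tu(3) _ False] s1 by auto
      ultimately have sR: "s \<in> R" using tu s1 by (simp add: R_def)
      have adj: "dist1 K s = dist1 K t + 1 \<or> dist1 K t = dist1 K s + 1"
        using dist1_adjacent[OF K, of t] False s1 by simp
      have "dist1 K t = dist1 K s + 1" if "0 < dist1 K t"
      proof -
        have "t \<notin> K" using that dist1_eq_0_iff[OF ne] by force
        then have "s \<in> K"
          using finite_sponge1_gap(2)[OF K nb(1,4), of t] tu ub s1 by simp
        then have "dist1 K s = 0" using dist1_eq_0_iff[OF ne] by simp
        with adj show ?thesis by simp
      qed
      with sR adj show ?thesis unfolding d by simp
    qed
  qed
  moreover have "a \<in> R" "b \<notin> R" "R \<subseteq> same_ends K a"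
    using \<open>a + 1 \<le> u\<close> ub by (auto simp: R_def)
  ultimately show ?thesis using that[of R] u1 ub by (simp add: u_def)
qed

lemma same_ends_uminus:
  assumes "finite_sponge1 K" "t \<in> same_ends (uminus ` K) (- a)"
  shows "- t \<in> same_ends K a"
proof -
  have "uminus ` uminus ` K = K" by (simp add: image_image)
  then show ?thesis
    using assms(2) lower_end_uminus[OF assms(1)] lower_end_uminus[OF finite_sponge1_uminus[OF assms(1)]]
    by (simp add: same_ends_def)
qed

text \<open>
  Resetting the distance at \<open>b\<close> to \<open>0\<close> makes \<open>b\<close> an improvement over \<open>a\<close>, although both lie in gaps
  of \<open>K\<close>.
\<close>

lemma crossing:
  assumes K: "finite_sponge1 K" and ab: "odd (b - a)" "a \<notin> K" "b \<notin> K"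
    and nb: "a - 1 \<in> K" "a + 1 \<in> K" "b - 1 \<in> K" "b + 1 \<in> K"
  obtains R where "a \<in> R" "b \<notin> R" "R \<subseteq> same_ends K a" "escape_towards K a b \<in> escape_values K a"
    "escape_towards K a b \<noteq> b" "descent ((dist1 K)(b := 0)) R {escape_towards K a b} b"
proof -
  have "a \<noteq> b" using ab(1) by auto
  then consider "a < b" | "b < a" by linarith
  then show thesis
  proof cases
    case 1
    from crossing_upwards[OF K 1 ab nb] obtain R where R: "a \<in> R" "b \<notin> R" "R \<subseteq> same_ends K a"
      "upper_end K a + 1 \<in> K" "upper_end K a + 1 \<noteq> b"
      "descent ((dist1 K)(b := 0)) R {upper_end K a + 1} b" .
    then show thesis using 1 by (intro that) (auto simp: escape_towards_def escape_values_def)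
  next
    case 2
    let ?K = "uminus ` K"
    have nb': "- a - 1 \<in> ?K" "- a + 1 \<in> ?K" "- b - 1 \<in> ?K" "- b + 1 \<in> ?K"
      using nb by (simp_all add: mem_uminus_image add.commute)
    have "odd (- b - (- a))" "- a \<notin> ?K" "- b \<notin> ?K" "- a < - b"
      using 2 ab by (simp_all add: mem_uminus_image)
    from crossing_upwards[OF finite_sponge1_uminus[OF K] this(4,1-3) nb'] obtain R where
      R: "- a \<in> R" "- b \<notin> R" "R \<subseteq> same_ends ?K (- a)" "upper_end ?K (- a) + 1 \<in> ?K"
        "upper_end ?K (- a) + 1 \<noteq> - b"
        "descent ((dist1 ?K)(- b := 0)) R {upper_end ?K (- a) + 1} (- b)" .
    define v where "v = lower_end K a - 1"
    have v: "upper_end ?K (- a) + 1 = - v" by (simp add: v_def lower_end_uminus[OF K])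
    have "(\<lambda>t. ((dist1 ?K)(- b := 0)) (- t)) = (dist1 K)(b := 0)"
      by (auto simp: dist1_uminus)
    with descent_uminus[OF R(6)] have "descent ((dist1 K)(b := 0)) (uminus ` R) {v} b"
      by (simp add: v)
    moreover have "a \<in> uminus ` R" "b \<notin> uminus ` R" using R(1,2) by (simp_all add: mem_uminus_image)
    moreover have "uminus ` R \<subseteq> same_ends K a" using R(3) same_ends_uminus[OF K] by blast
    moreover have "v \<in> K" "v \<noteq> b" using R(4,5) unfolding v mem_uminus_image by auto
    ultimately show thesis
      using 2 by (intro that[of "uminus ` R"]) (auto simp: escape_towards_def escape_values_def v_def)
  qed
qed

section \<open>Environments and escapes\<close>

definition env :: "('n \<Rightarrow> int set) \<Rightarrow> int ^ 'n \<Rightarrow> 'n \<Rightarrow> int set" where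
  "env F x k = environment1 (F k) (x $ k)"

lemma finite_sponge1_env: "finite_sponge1 (F k) \<Longrightarrow> finite_sponge1 (env F x k)"
  by (simp add: env_def finite_sponge1_environment1)

lemma env_subset: "env F x k \<subseteq> F k"
  by (simp add: env_def environment1_subset)

lemma mu_pt_fun_upd:
  fixes x :: "int ^ 'n"
  assumes "\<And>k. F k \<noteq> {}" "A \<noteq> {}"
  shows "mu_pt x (cart_prod (F(i := A))) = (\<Sum>k\<in>UNIV - {i}. dist1 (F k) (x $ k)) + dist1 A (x $ i)"
proof -
  have "mu_pt x (cart_prod (F(i := A))) = (\<Sum>k\<in>UNIV. dist1 ((F(i := A)) k) (x $ k))"
    using assms by (intro mu_pt_cart_prod) auto
  also have "\<dots> = dist1 A (x $ i) + (\<Sum>k\<in>UNIV - {i}. dist1 ((F(i := A)) k) (x $ k))"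
    by (subst sum.remove[of UNIV i]) auto
  also have "(\<Sum>k\<in>UNIV - {i}. dist1 ((F(i := A)) k) (x $ k)) = (\<Sum>k\<in>UNIV - {i}. dist1 (F k) (x $ k))"
    by (rule sum.cong) auto
  finally show ?thesis by (simp only: add.commute)
qed

text \<open>General in \<open>d\<close> in order to cover both the true distances and the altered
  ones of a crossing. Since \<open>d\<close> agrees with the distance wherever the walk can stop,
  the total reached bounds a distance from the environment or from an escape; elsewhere, notably at
  the target, \<open>d\<close> is free.\<close>

lemma improvement_in_env_or_escape:
  fixes x y :: "int ^ 'n"
  assumes J: "jump_system J" "x \<in> J" "y \<in> J" and F: "\<And>k. finite_sponge1 (F k)"
    and desc: "\<And>k. descent (d k) (R k) (X k) (y $ k)"
    and R: "\<And>k. x $ k \<in> R k" "\<And>k. R k \<subseteq> same_ends (F k) (x $ k)"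
    and X: "\<And>k. X k \<subseteq> F k"
    and d: "\<And>k. \<forall>t\<in>R k \<union> X k. d k t = dist1 (F k) t"
    and lt: "(\<Sum>k\<in>UNIV. d k (y $ k)) < mu_pt x (cart_prod F)"
  obtains w where "w \<in> J" "mu_pt w (cart_prod (env F x)) < mu_pt x (cart_prod F)"
  | w i v where "w \<in> J" "v \<in> X i" "mu_pt w (cart_prod ((env F x)(i := {v}))) < mu_pt x (cart_prod F)"
proof -
  note ne = finite_sponge1_nonempty[OF F] finite_sponge1_nonempty[OF finite_sponge1_env[OF F]]
  have sx: "(\<Sum>k\<in>UNIV. d k (x $ k)) = mu_pt x (cart_prod F)"
    using d R(1) by (simp add: mu_pt_cart_prod[OF ne(1)])
  have env: "dist1 (env F x k) t = d k t" if "t \<in> R k" for k t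
    using that R(2)[of k] d[of k] dist1_environment1[OF F, of k t]
      environment1_same_ends[of t "F k" "x $ k"] by (auto simp: env_def)
  from jump_system_descent[OF J(1,3) desc J(2) R(1)] lt sx obtain w where
    w: "w \<in> J" "(\<Sum>k\<in>UNIV. d k (w $ k)) < mu_pt x (cart_prod F)"
    "(\<forall>k. w $ k \<in> R k) \<or> (\<exists>i. w $ i \<in> X i \<and> (\<forall>k. k \<noteq> i \<longrightarrow> w $ k \<in> R k))" by metis
  from w(3) show thesis
  proof
    assume "\<forall>k. w $ k \<in> R k"
    then have "mu_pt w (cart_prod (env F x)) = (\<Sum>k\<in>UNIV. d k (w $ k))"
      by (simp add: mu_pt_cart_prod[OF ne(2)] env)
    with w that(1) show thesis by simp
  next
    assume "\<exists>i. w $ i \<in> X i \<and> (\<forall>k. k \<noteq> i \<longrightarrow> w $ k \<in> R k)"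
    then obtain i where i: "w $ i \<in> X i" "\<And>k. k \<noteq> i \<Longrightarrow> w $ k \<in> R k" by blast
    have "mu_pt w (cart_prod ((env F x)(i := {w $ i})))
        = (\<Sum>k\<in>UNIV - {i}. dist1 (env F x k) (w $ k)) + dist1 {w $ i} (w $ i)"
      by (rule mu_pt_fun_upd) (auto simp: ne(2))
    also have "\<dots> = (\<Sum>k\<in>UNIV - {i}. d k (w $ k)) + dist1 {w $ i} (w $ i)"
      using i(2) by (simp add: env)
    also have "\<dots> \<le> (\<Sum>k\<in>UNIV. d k (w $ k))"
      using dist1_eq_0_iff[of "{w $ i}" "w $ i"] by (subst sum.remove[of UNIV i]) auto
    finally show thesis using w that(2)[OF w(1) i(1)] by simp
  qed
qed

lemma not_optimal_improvement:
  fixes x y :: "int ^ 'n"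
  assumes J: "jump_system J" "x \<in> J" "y \<in> J" and F: "\<And>k. finite_sponge1 (F k)"
    and lt: "mu_pt y (cart_prod F) < mu_pt x (cart_prod F)"
  obtains w where "w \<in> J" "mu_pt w (cart_prod (env F x)) < mu_pt x (cart_prod F)"
  | w i v where "w \<in> J" "v \<in> escape_values (F i) (x $ i)"
      "mu_pt w (cart_prod ((env F x)(i := {v}))) < mu_pt x (cart_prod F)"
proof (rule improvement_in_env_or_escape[OF J F descent_dist1[OF F]])
  show "x $ k \<in> same_ends (F k) (x $ k)" for k by simp
  show "escape_values (F k) (x $ k) \<subseteq> F k" for k by (simp add: escape_values_def)
  show "(\<Sum>k\<in>UNIV. dist1 (F k) (y $ k)) < mu_pt x (cart_prod F)"
    using lt by (simp add: mu_pt_cart_prod[of F y] finite_sponge1_nonempty[OF F])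
qed (use that in auto)

lemma sponge_cart_prod:
  assumes "\<And>k. finite_sponge1 (F k)"
  shows "sponge (cart_prod F)"
  unfolding sponge_def
proof (rule exI[of _ F], intro conjI allI refl)
  fix k
  note K = assms[of k] finite_sponge1_nonempty[OF assms[of k]]
  show "sponge1 (F k)" using K(1) by (simp add: finite_sponge1_def)
  have fin: "finite (F k)" using K(1) by (simp add: finite_sponge1_def)
  show "\<exists>l\<in>F k. \<forall>h\<in>F k. l \<le> h" using fin K(2) by (intro bexI[of _ "Min (F k)"]) auto
  show "\<exists>u\<in>F k. \<forall>h\<in>F k. h \<le> u" using fin K(2) by (intro bexI[of _ "Max (F k)"]) auto
qed

lemma spongeE:
  assumes "sponge H"
  obtains F where "H = cart_prod F" "\<And>k. finite_sponge1 (F k)"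
proof -
  obtain F where H: "H = cart_prod F" and F: "\<And>k. sponge1 (F k)"
    "\<And>k. \<exists>l\<in>F k. \<forall>h\<in>F k. l \<le> h" "\<And>k. \<exists>u\<in>F k. \<forall>h\<in>F k. h \<le> u"
    using assms unfolding sponge_def by auto
  have "finite (F k)" for k
  proof -
    obtain l u where "F k \<subseteq> {l..u}" using F(2,3)[of k] by (auto simp: subset_iff)
    then show ?thesis by (rule finite_subset) simp
  qed
  with F(1) H show thesis by (intro that) (auto simp: finite_sponge1_def)
qed

lemma environment_cart_prod:
  assumes "\<And>k. F k \<noteq> {}"
  shows "environment (cart_prod F) x = cart_prod (env F x)"
  unfolding environment_def factor_cart_prod[OF assms] env_def[abs_def] ..

lemma escape_cart_prod:
  assumes "\<And>k. F k \<noteq> {}"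
  shows "lower_escape (cart_prod F) x i = Some K \<or> upper_escape (cart_prod F) x i = Some K \<longleftrightarrow>
    (\<exists>v\<in>escape_values (F i) (x $ i). K = cart_prod ((env F x)(i := {v})))"
proof -
  have e: "(\<lambda>j. environment1 (F j) (x $ j)) = env F x" by (simp add: env_def[abs_def])
  show ?thesis
    unfolding lower_escape_def upper_escape_def factor_cart_prod[OF assms] e
    by (auto simp: lower_escape_value_def upper_escape_value_def escape_values_def)
qed

lemma cart_prod_mono: "(\<And>k. F k \<subseteq> G k) \<Longrightarrow> cart_prod F \<subseteq> cart_prod G"
  by (auto simp: cart_prod_def)

lemma cart_prod_env_subset: "cart_prod (env F x) \<subseteq> cart_prod F"
  by (intro cart_prod_mono env_subset)

lemma env_fun_upd_subset: "A \<subseteq> F i \<Longrightarrow> cart_prod ((env F x)(i := A)) \<subseteq> cart_prod F"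
  using env_subset[of F x] by (intro cart_prod_mono) auto

lemma cart_prod_env_nonempty:
  assumes "\<And>k. finite_sponge1 (F k)"
  shows "cart_prod (env F x) \<noteq> {}" "A \<noteq> {} \<Longrightarrow> cart_prod ((env F x)(i := A)) \<noteq> {}"
proof -
  have ne: "env F x k \<noteq> {}" for k
    by (rule finite_sponge1_nonempty[OF finite_sponge1_env]) (rule assms)
  show "cart_prod (env F x) \<noteq> {}" by (rule cart_prod_nonempty) (rule ne)
  show "cart_prod ((env F x)(i := A)) \<noteq> {}" if "A \<noteq> {}"
    by (rule cart_prod_nonempty) (simp add: ne that)
qed

text \<open>One direction is the descent with the true distances. Conversely, the environment and
  the defined escapes are nonempty subsets of \<open>H\<close>, so being close to one of them means
  being close to \<open>H\<close>.\<close>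

lemma not_optimal_iff:
  fixes x :: "int ^ 'n"
  assumes H: "sponge H" and J: "jump_system J" "x \<in> J"
  shows "\<not> optimal J H x \<longleftrightarrow>
    (\<exists>y\<in>J. mu_pt y (environment H x) < mu_pt x H \<or>
      (\<exists>i K. (lower_escape H x i = Some K \<or> upper_escape H x i = Some K) \<and>
        mu_pt y K < mu_pt x H))" (is "_ \<longleftrightarrow> ?R")
proof -
  obtain F where F: "H = cart_prod F" "\<And>k. finite_sponge1 (F k)" using spongeE[OF H] by metis
  note ne = finite_sponge1_nonempty[OF F(2)]
  have opt: "\<not> optimal J H x \<longleftrightarrow> (\<exists>y\<in>J. mu_pt y (cart_prod F) < mu_pt x (cart_prod F))"
    unfolding F(1) optimal_iff[OF cart_prod_nonempty[OF ne]] using J(2) by (auto simp: not_le)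
  have R: "?R \<longleftrightarrow> (\<exists>y\<in>J. mu_pt y (cart_prod (env F x)) < mu_pt x (cart_prod F) \<or>
      (\<exists>i. \<exists>v\<in>escape_values (F i) (x $ i).
        mu_pt y (cart_prod ((env F x)(i := {v}))) < mu_pt x (cart_prod F)))"
    unfolding F(1) environment_cart_prod[OF ne] escape_cart_prod[OF ne] by blast
  have less: "mu_pt y (cart_prod F) < mu_pt x (cart_prod F)"
    if "mu_pt y K < mu_pt x (cart_prod F)" "K \<subseteq> cart_prod F" "K \<noteq> {}" for y K
    using mu_pt_antimono[OF that(2,3), of y] that(1) by simp
  show ?thesis unfolding opt R
  proof
    assume "\<exists>y\<in>J. mu_pt y (cart_prod F) < mu_pt x (cart_prod F)"
    then obtain y where y: "y \<in> J" "mu_pt y (cart_prod F) < mu_pt x (cart_prod F)" by blast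
    from not_optimal_improvement[OF J y(1) F(2) y(2)]
    show "\<exists>y\<in>J. mu_pt y (cart_prod (env F x)) < mu_pt x (cart_prod F) \<or>
      (\<exists>i. \<exists>v\<in>escape_values (F i) (x $ i).
        mu_pt y (cart_prod ((env F x)(i := {v}))) < mu_pt x (cart_prod F))"
      by metis
  next
    assume "\<exists>y\<in>J. mu_pt y (cart_prod (env F x)) < mu_pt x (cart_prod F) \<or>
      (\<exists>i. \<exists>v\<in>escape_values (F i) (x $ i).
        mu_pt y (cart_prod ((env F x)(i := {v}))) < mu_pt x (cart_prod F))"
    then obtain y where "y \<in> J" and "mu_pt y (cart_prod (env F x)) < mu_pt x (cart_prod F) \<or>
      (\<exists>i. \<exists>v\<in>escape_values (F i) (x $ i).
        mu_pt y (cart_prod ((env F x)(i := {v}))) < mu_pt x (cart_prod F))" by blast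
    from this(2) have "mu_pt y (cart_prod F) < mu_pt x (cart_prod F)"
    proof (elim disjE exE bexE)
      assume "mu_pt y (cart_prod (env F x)) < mu_pt x (cart_prod F)"
      then show ?thesis
        by (rule less) (rule cart_prod_env_subset, rule cart_prod_env_nonempty[OF F(2)])
    next
      fix i v assume "v \<in> escape_values (F i) (x $ i)"
        "mu_pt y (cart_prod ((env F x)(i := {v}))) < mu_pt x (cart_prod F)"
      then show ?thesis
        by (intro less[OF _ env_fun_upd_subset cart_prod_env_nonempty(2)[OF F(2)]])
          (auto simp: escape_values_def)
    qed
    with \<open>y \<in> J\<close> show "\<exists>y\<in>J. mu_pt y (cart_prod F) < mu_pt x (cart_prod F)" by blast
  qed
qed

section \<open>Parity sponges and parity classes\<close>

text \<open>A missing integer of the right parity would be a gap, whose neighbours in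
  \<open>K\<close> have the wrong parity.\<close>

lemma same_parity_sponge1_eq:
  assumes K: "finite_sponge1 K" "same_parity K"
  shows "K = {h. Min K \<le> h \<and> h \<le> Max K \<and> even (h - Min K)}"
proof -
  have fin: "finite K" "K \<noteq> {}" using K(1) finite_sponge1_nonempty by (auto simp: finite_sponge1_def)
  have "h \<in> K" if h: "Min K \<le> h" "h \<le> Max K" "even (h - Min K)" for h
  proof (rule ccontr)
    assume n: "h \<notin> K"
    then have "h \<noteq> Min K" "h \<noteq> Max K" using Min_in[OF fin] Max_in[OF fin] by auto
    then have "h - 1 \<in> K"
      using finite_sponge1_gap(1)[OF K(1) Min_in[OF fin] Max_in[OF fin] _ _ n] h by simp
    from same_parityD[OF K(2) this Min_in[OF fin]] h(3) show False by simp
  qed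
  moreover have "Min K \<le> h \<and> h \<le> Max K \<and> even (h - Min K)" if "h \<in> K" for h
    using same_parityD[OF K(2) that Min_in[OF fin]] that fin by simp
  ultimately show ?thesis by blast
qed

lemma parity_sponge_cart_prod:
  assumes F: "\<And>k. finite_sponge1 (F k)" "\<And>k. same_parity (F k)"
  shows "parity_sponge (cart_prod F)"
  unfolding parity_sponge_def factor_cart_prod[OF finite_sponge1_nonempty[OF F(1)]]
proof (intro conjI allI)
  show "sponge (cart_prod F)" by (rule sponge_cart_prod[OF F(1)])
  fix k
  have fin: "finite (F k)" "F k \<noteq> {}"
    using F(1)[of k] finite_sponge1_nonempty[OF F(1)] by (auto simp: finite_sponge1_def)
  have "Min (F k) \<le> Max (F k)" using fin by simp
  moreover have "even (Max (F k) - Min (F k))"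
    using same_parityD[OF F(2) Max_in[OF fin] Min_in[OF fin]] by simp
  ultimately  show "\<exists>l u. l \<le> u \<and> even (u - l) \<and> F k = {h. l \<le> h \<and> h \<le> u \<and> even (h - l)}"
    using same_parity_sponge1_eq[OF F, of k] by blast
qed

text \<open>An escape value is a member next to an end, hence of the other parity. This is why
  coordinates still holding a parity class cost no escape queries.\<close>

lemma escape_values_same_parity:
  assumes "finite_sponge1 K" "same_parity K"
  shows "escape_values K z = {}"
  using same_parityD[OF assms(2) lower_end_props(1)[OF assms(1)], of "lower_end K z - 1" z]
    same_parityD[OF assms(2) upper_end_props(1)[OF assms(1)], of "upper_end K z + 1" z]
  by (auto simp: escape_values_def)

text \<open>Parity is counted from \<open>Min K\<close>. For nonempty finite \<open>K\<close> this
  class is therefore nonempty, whereas the other one is empty if \<open>K\<close> is a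
  singleton.\<close>

definition even_class :: "int set \<Rightarrow> int set" where
  "even_class K = {h. Min K \<le> h \<and> h \<le> Max K \<and> even (h - Min K)}"

definition odd_class :: "int set \<Rightarrow> int set" where
  "odd_class K = {h. Min K \<le> h \<and> h \<le> Max K \<and> odd (h - Min K)}"

text \<open>Symmetric in \<open>P\<close> and \<open>Q\<close>, because the class that holds the
  better point may be either of them.\<close>

definition complementary_classes :: "int set \<Rightarrow> int set \<Rightarrow> int set \<Rightarrow> bool" where
  "complementary_classes K P Q \<longleftrightarrow> finite_sponge1 K \<and> finite_sponge1 P \<and> finite_sponge1 Q \<and>
     same_parity P \<and> same_parity Q \<and> (\<forall>p\<in>P. \<forall>q\<in>Q. odd (p - q)) \<and> P \<union> Q = {Min K..Max K}"

lemma complementary_classes_sym: "complementary_classes K P Q \<Longrightarrow> complementary_classes K Q P"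
  unfolding complementary_classes_def by (auto simp: Un_commute)

lemma finite_sponge1_even_class:
  assumes "finite_sponge1 K"
  shows "finite_sponge1 (even_class K)" "same_parity (even_class K)"
proof -
  have fin: "finite K" "K \<noteq> {}" using assms finite_sponge1_nonempty by (auto simp: finite_sponge1_def)
  then have "Min K \<in> even_class K" by (simp add: even_class_def)
  moreover have "finite (even_class K)"
    by (rule finite_subset[of _ "{Min K..Max K}"]) (auto simp: even_class_def)
  ultimately show "finite_sponge1 (even_class K)"
    unfolding finite_sponge1_def sponge1_def by (auto simp: even_class_def)
  show "same_parity (even_class K)"
    unfolding same_parity_def even_class_def by auto
qed

text \<open>The second hypothesis excludes a singleton \<open>K\<close>, whose odd class is empty
  and hence not a sponge.\<close>

lemma complementary_even_odd_class:
  assumes K: "finite_sponge1 K" and ne: "even_class K \<noteq> K"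
  shows "complementary_classes K (even_class K) (odd_class K)"
proof -
  have fin: "finite K" "K \<noteq> {}" using K finite_sponge1_nonempty by (auto simp: finite_sponge1_def)
  have "Min K \<noteq> Max K"
  proof
    assume eq: "Min K = Max K"
    have "K \<subseteq> {Min K..Max K}" using fin by auto
    then have "K \<subseteq> {Min K}" using eq by simp
    moreover have "Min K \<in> K" using fin by simp
    ultimately have "K = {Min K}" by blast
    moreover have "even_class K = {Min K}" using eq by (auto simp: even_class_def)
    ultimately show False using ne by simp
  qed
  moreover have "Min K \<le> Max K" using fin by simp
  ultimately have "Min K + 1 \<in> odd_class K" by (simp add: odd_class_def)
  moreover have "finite (odd_class K)"
    by (rule finite_subset[of _ "{Min K..Max K}"]) (auto simp: odd_class_def)
  ultimately have "finite_sponge1 (odd_class K)"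
    unfolding finite_sponge1_def sponge1_def by (auto simp: odd_class_def)
  moreover have "same_parity (odd_class K)"
    unfolding same_parity_def odd_class_def by auto
  moreover have "even_class K \<union> odd_class K = {Min K..Max K}"
    by (auto simp: even_class_def odd_class_def)
  ultimately show ?thesis
    using finite_sponge1_even_class[OF K] K
    unfolding complementary_classes_def by (auto simp: even_class_def odd_class_def)
qed

section \<open>Distances and environments relative to two complementary classes\<close>

context
  fixes K P Q :: "int set"
  assumes PQ: "complementary_classes K P Q"
begin

lemma classes_sponge1: "finite_sponge1 K" "finite_sponge1 P" "finite_sponge1 Q" "same_parity P" "same_parity Q"
  and classes_odd: "p \<in> P \<Longrightarrow> q \<in> Q \<Longrightarrow> odd (p - q)"
  and classes_Un: "P \<union> Q = {Min K..Max K}"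
  using PQ by (simp_all add: complementary_classes_def)

lemma classes_nonempty: "K \<noteq> {}" "P \<noteq> {}" "Q \<noteq> {}"
  using finite_sponge1_nonempty classes_sponge1(1-3) by blast+

lemma classes_finite: "finite K"
  using classes_sponge1(1) by (simp add: finite_sponge1_def)

lemma subset_classes: "K \<subseteq> P \<union> Q"
  unfolding classes_Un using classes_finite by auto

lemma finite_sponge1_classes: "finite_sponge1 (P \<union> Q)"
proof -
  have "Min K \<le> Max K" using classes_finite classes_nonempty by simp
  then show ?thesis unfolding finite_sponge1_def sponge1_def classes_Un by auto
qed

text \<open>The neighbour of a nearest \<open>p\<close>, taken on the side of some element of
  \<open>Q\<close>, stays in the interval and has the other parity.\<close>

lemma dist1_other_class: "dist1 Q t \<le> dist1 P t + 1"
proof -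
  obtain p where p: "p \<in> P" "dist1 P t = nat \<bar>t - p\<bar>" using dist1_attained[OF classes_nonempty(2)] .
  obtain q where q: "q \<in> Q" using classes_nonempty by blast
  have "p \<noteq> q" using classes_odd[OF p(1) q] by auto
  define r where "r = p + sgn (q - p)"
  have r: "\<bar>r - p\<bar> = 1" using \<open>p \<noteq> q\<close> by (auto simp: r_def sgn_if)
  have "p \<in> {Min K..Max K}" "q \<in> {Min K..Max K}" using p(1) q classes_Un by blast+
  then have "r \<in> P \<union> Q" unfolding classes_Un using \<open>p \<noteq> q\<close> by (auto simp: r_def sgn_if)
  moreover have "r \<notin> P"
  proof
    assume "r \<in> P"
    from same_parityD[OF classes_sponge1(4) this p(1)] \<open>p \<noteq> q\<close> show False
      by (auto simp: r_def sgn_if split: if_splits)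
  qed
  ultimately have "r \<in> Q" by blast
  from dist1_le[OF this, of t] show ?thesis using p(2) r by linarith
qed

text \<open>A class element missing from \<open>K\<close> lies strictly between \<open>Min K\<close>
  and \<open>Max K\<close>, so its neighbours are in \<open>K\<close>.\<close>

lemma dist1_le_class: "dist1 K t \<le> dist1 P t + 1"
proof -
  obtain p where p: "p \<in> P" "dist1 P t = nat \<bar>t - p\<bar>" using dist1_attained[OF classes_nonempty(2)] .
  show ?thesis
  proof (cases "p \<in> K")
    case True
    then show ?thesis using dist1_le[OF True, of t] p by simp
  next
    case False
    have mem: "Min K \<in> K" "Max K \<in> K" using classes_finite classes_nonempty by simp_all
    have "p \<in> {Min K..Max K}" using p(1) classes_Un by blast
    moreover have "p \<noteq> Min K" "p \<noteq> Max K" using False mem by auto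
    ultimately have "p + 1 \<in> K"
      by (intro finite_sponge1_gap(2)[OF classes_sponge1(1) mem _ _ False]) auto
    from dist1_le[OF this, of t] show ?thesis using p(2) by linarith
  qed
qed

text \<open>At or beyond the extremes of \<open>K\<close> no class element is nearer than
  \<open>Min K\<close> or \<open>Max K\<close>. Hence \<open>t\<close> is a gap of \<open>K\<close>
  at distance one, which leaves distance 0 for the class.\<close>

lemma class_gap:
  assumes "dist1 P t < dist1 K t"
  shows "t \<in> P" "t \<notin> K" "t - 1 \<in> K" "t + 1 \<in> K"
proof -
  obtain p where p: "p \<in> P" "dist1 P t = nat \<bar>t - p\<bar>" using dist1_attained[OF classes_nonempty(2)] .
  have mem: "Min K \<in> K" "Max K \<in> K" using classes_finite classes_nonempty by simp_all
  have *: "dist1 K t \<le> nat \<bar>t - Min K\<bar>" "dist1 K t \<le> nat \<bar>t - Max K\<bar>"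
    using dist1_le mem by auto
  have "p \<in> {Min K..Max K}" using p(1) classes_Un by blast
  then have "Min K < t" "t < Max K" using * p(2) assms by (auto simp: not_less[symmetric])
  moreover show n: "t \<notin> K" using assms dist1_eq_0_iff[OF classes_nonempty(1), of t] by auto
  ultimately show K: "t - 1 \<in> K" "t + 1 \<in> K"
    using finite_sponge1_gap[OF classes_sponge1(1) mem _ _ n] by auto
  from dist1_le[OF K(2), of t] assms have "dist1 P t = 0" by simp
  then show "t \<in> P" using dist1_eq_0_iff[OF classes_nonempty(2)] by simp
qed

text \<open>The neighbour \<open>t + 1\<close> is a nearest element, so it lies in the environment,
  and its parity is opposite to that of \<open>t\<close>, which is in \<open>P\<close>.\<close>

lemma environment1_class_gap:
  assumes "dist1 P t < dist1 K t"
  shows "environment1 K t \<subseteq> Q"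
proof
  fix e assume e: "e \<in> environment1 K t"
  note gap = class_gap[OF assms]
  have "dist1 K t = 1"
    using dist1_le[OF gap(4), of t] gap(2) dist1_eq_0_iff[OF classes_nonempty(1), of t] by force
  then have "t + 1 \<in> environment1 K t"
    by (intro nearest_mem_environment1[OF classes_sponge1(1) gap(4)]) simp
  from same_parityD[OF same_parity_environment1[OF classes_sponge1(1)] this e]
  have "e \<notin> P" using same_parityD[OF classes_sponge1(4) gap(1), of e] by auto
  then show "e \<in> Q" using e environment1_subset subset_classes by blast
qed

text \<open>A nearest element in \<open>P\<close> puts the whole environment into \<open>P\<close>
  by parity; one step beyond its ends changes the parity.\<close>

lemma environment1_classes:
  assumes "dist1 (P \<union> Q) t = dist1 P t"
  shows "environment1 (P \<union> Q) t \<subseteq> P" "escape_values (P \<union> Q) t \<subseteq> Q"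
proof -
  note B = finite_sponge1_classes
  obtain p where p: "p \<in> P" "dist1 P t = nat \<bar>t - p\<bar>" using dist1_attained[OF classes_nonempty(2)] .
  then have pe: "p \<in> environment1 (P \<union> Q) t"
    using assms by (intro nearest_mem_environment1[OF B]) auto
  have Q: "e \<notin> Q" if "e \<in> environment1 (P \<union> Q) t" for e
    using same_parityD[OF same_parity_environment1[OF B] pe that] classes_odd[OF p(1), of e] by auto
  then show sub: "environment1 (P \<union> Q) t \<subseteq> P" using environment1_subset by blast
  have "lower_end (P \<union> Q) t \<in> environment1 (P \<union> Q) t" "upper_end (P \<union> Q) t \<in> environment1 (P \<union> Q) t"
    using pe lower_end_props(1)[OF B, of t] upper_end_props(1)[OF B, of t]
    by (auto simp: environment1_def)
  with sub have ends: "lower_end (P \<union> Q) t \<in> P" "upper_end (P \<union> Q) t \<in> P" by blast+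
  show "escape_values (P \<union> Q) t \<subseteq> Q"
    using same_parityD[OF classes_sponge1(4) ends(1), of "lower_end (P \<union> Q) t - 1"]
      same_parityD[OF classes_sponge1(4) ends(2), of "upper_end (P \<union> Q) t + 1"]
    by (auto simp: escape_values_def)
qed

lemma dist1_classes_cases: "dist1 P t \<le> dist1 K t \<or> dist1 Q t \<le> dist1 K t"
proof -
  obtain h where h: "h \<in> K" "dist1 K t = nat \<bar>t - h\<bar>" using dist1_attained[OF classes_nonempty(1)] .
  with subset_classes have "h \<in> P \<or> h \<in> Q" by blast
  then show ?thesis using dist1_le[of h] h(2) by metis
qed

end

section \<open>Changing the factor of one coordinate\<close>

lemma env_fun_upd: "env (F(i := A)) x = (env F x)(i := environment1 A (x $ i))"
  by (rule ext) (simp add: env_def)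

lemma mu_pt_env_self:
  fixes x :: "int ^ 'n"
  assumes "\<And>k. finite_sponge1 (F k)" "A \<noteq> {}"
  shows "mu_pt x (cart_prod ((env F x)(i := A))) = mu_pt x (cart_prod (F(i := A)))"
proof -
  have "env F x k \<noteq> {}" "F k \<noteq> {}" for k
    using assms(1) by (simp_all add: finite_sponge1_nonempty finite_sponge1_env)
  then show ?thesis
    using assms by (simp add: mu_pt_fun_upd dist1_environment1 env_def)
qed

locale class_change =
  fixes J :: "(int ^ 'n) set" and F :: "'n \<Rightarrow> int set" and i :: 'n and K P Q :: "int set"
  assumes J: "jump_system J" and F: "\<And>k. finite_sponge1 (F k)"
    and PQ: "complementary_classes K P Q"
begin

abbreviation "muP x \<equiv> mu_pt x (cart_prod (F(i := P)))"
abbreviation "muQ x \<equiv> mu_pt x (cart_prod (F(i := Q)))"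
abbreviation "muK x \<equiv> mu_pt x (cart_prod (F(i := K)))"

lemmas F_nonempty = finite_sponge1_nonempty[OF F]

lemma mu_pt_upd:
  "A \<noteq> {} \<Longrightarrow> mu_pt x (cart_prod (F(i := A))) = (\<Sum>k\<in>UNIV - {i}. dist1 (F k) (x $ k)) + dist1 A (x $ i)"
  by (rule mu_pt_fun_upd) (rule F_nonempty)

lemma mu_pt_upd_le:
  assumes "A \<noteq> {}" "B \<noteq> {}" "dist1 A (x $ i) \<le> dist1 B (x $ i) + c"
  shows "mu_pt x (cart_prod (F(i := A))) \<le> mu_pt x (cart_prod (F(i := B))) + c"
  using assms by (simp add: mu_pt_upd)

lemma finite_sponge1_upd: "finite_sponge1 A \<Longrightarrow> finite_sponge1 ((F(i := A)) k)"
  using F by simp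

lemma muK_ge:
  assumes "v \<le> muP y" "v \<le> muQ y"
  shows "v \<le> muK y"
proof -
  note ne = classes_nonempty[OF PQ]
  from dist1_classes_cases[OF PQ, of "y $ i"] show ?thesis
  proof
    assume "dist1 P (y $ i) \<le> dist1 K (y $ i)"
    with assms(1) mu_pt_upd_le[OF ne(2,1), of y 0] show ?thesis by simp
  next
    assume "dist1 Q (y $ i) \<le> dist1 K (y $ i)"
    with assms(2) mu_pt_upd_le[OF ne(3,1), of y 0] show ?thesis by simp
  qed
qed

text \<open>Together with \<open>muK_ge\<close>: if \<open>v\<close> is the smaller of the two class
  optima, the optimum for \<open>K\<close> is \<open>v\<close> or \<open>v + 1\<close>.\<close>

lemma muK_le: "muK y \<le> muP y + 1"
  by (rule mu_pt_upd_le[OF classes_nonempty(1,2)[OF PQ] dist1_le_class[OF PQ]])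

lemma muQ_le: "muQ y \<le> muP y + 1"
  by (rule mu_pt_upd_le[OF classes_nonempty(3,2)[OF PQ] dist1_other_class[OF PQ]])

lemma env_upd_subset: "A \<subseteq> B \<Longrightarrow> cart_prod ((env F x)(i := A)) \<subseteq> cart_prod (F(i := B))"
  using env_subset[of F x] by (intro cart_prod_mono) auto

lemma env_upd_nonempty: "A \<noteq> {} \<Longrightarrow> cart_prod ((env F x)(i := A)) \<noteq> {}"
  by (rule cart_prod_env_nonempty(2)[of F, OF F])

text \<open>
  If the class \<open>Q\<close> is better than the class \<open>P\<close>, then it is so already on the environment of a
  \<open>P\<close>-optimal \<open>x\<close>: as seen from \<open>x\<close>, the classes are the environment and the escapes of \<open>P \<union> Q\<close>.
\<close>

lemma other_class_better_on_env:
  assumes x: "x \<in> J" "\<And>y. y \<in> J \<Longrightarrow> muP x \<le> muP y" and y: "y \<in> J" "muQ y < muP x"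
  obtains w where "w \<in> J" "mu_pt w (cart_prod ((env F x)(i := Q))) < muP x"
proof (cases "dist1 (P \<union> Q) (x $ i) < dist1 P (x $ i)")
  case True
  \<comment> \<open>The nearest point of the interval lies in \<open>Q\<close>, so \<open>x\<close>
    itself serves as \<open>w\<close>.\<close>
  obtain b where b: "b \<in> P \<union> Q" "dist1 (P \<union> Q) (x $ i) = nat \<bar>x $ i - b\<bar>"
    using dist1_attained[OF finite_sponge1_nonempty[OF finite_sponge1_classes[OF PQ]]] .
  then have "b \<in> Q" using True dist1_le[of b P "x $ i"] by auto
  with b True have "dist1 Q (x $ i) < dist1 P (x $ i)" using dist1_le[of b Q "x $ i"] by simp
  then have "mu_pt x (cart_prod ((env F x)(i := Q))) < muP x"
    using classes_nonempty[OF PQ] by (simp add: mu_pt_env_self[of F, OF F] mu_pt_upd)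
  with x(1) that show ?thesis by blast
next
  case False
  let ?B = "P \<union> Q"
  note B = finite_sponge1_classes[OF PQ]
  have neB: "?B \<noteq> {}" "Q \<noteq> {}" "P \<noteq> {}" using classes_nonempty[OF PQ] by auto
  have eq: "dist1 ?B (x $ i) = dist1 P (x $ i)"
    using False dist1_antimono[of P ?B "x $ i"] neB by auto
  then have mux: "mu_pt x (cart_prod (F(i := ?B))) = muP x"
    using neB by (simp add: mu_pt_upd)
  have "mu_pt y (cart_prod (F(i := ?B))) \<le> muQ y"
    using mu_pt_upd_le[OF neB(1,2), of y 0] dist1_antimono[of Q ?B "y $ i"] neB by simp
  with y(2) mux have lt: "mu_pt y (cart_prod (F(i := ?B))) < mu_pt x (cart_prod (F(i := ?B)))" by simp
  \<comment> \<open>The optimality of \<open>x\<close> rules out everything inside the product with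
    \<open>P\<close>. What remains is an escape in coordinate \<open>i\<close>, whose value lies in
    \<open>Q\<close>.\<close>
  have no: "\<not> mu_pt w S < muP x" if "w \<in> J" "S \<subseteq> cart_prod (F(i := P))" "S \<noteq> {}" for w S
    using mu_pt_antimono[OF that(2,3), of w] x(2)[OF that(1)] by simp
  note sub = environment1_classes[OF PQ eq]
  note nee = environment1_nonempty[OF B]
  from not_optimal_improvement[where F = "F(i := ?B)", OF J x(1) y(1) finite_sponge1_upd[OF B] lt]
  show ?thesis
  proof cases
    case (1 w)
    then show ?thesis
      using no[OF 1(1) env_upd_subset[OF sub(1)] env_upd_nonempty[OF nee]]
      unfolding mux env_fun_upd by blast
  next
    case (2 w k v)
    show ?thesis
    proof (cases "k = i")
      case True
      with 2(2) sub(2) have v: "v \<in> Q" by auto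
      have "mu_pt w (cart_prod ((env F x)(i := Q))) \<le> mu_pt w (cart_prod ((env F x)(i := {v})))"
        using v by (intro mu_pt_antimono cart_prod_mono env_upd_nonempty) auto
      with 2 True that mux show ?thesis unfolding env_fun_upd by simp
    next
      case False
      let ?S = "cart_prod ((env (F(i := ?B)) x)(k := {v}))"
      have "v \<in> F k" using 2(2) False by (auto simp: escape_values_def)
      then have "?S \<subseteq> cart_prod (F(i := P))"
        using sub(1) False env_subset[of F x] unfolding env_fun_upd
        by (intro cart_prod_mono) auto
      moreover have "?S \<noteq> {}"
        by (rule cart_prod_env_nonempty(2)[where F = "F(i := ?B)", OF finite_sponge1_upd[OF B]]) simp
      ultimately show ?thesis using no[OF 2(1)] 2(3) unfolding mux by blast
    qed
  qed
qed

text \<open>If \<open>x\<close> loses by passing from \<open>P\<close> to \<open>K\<close>, then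
  \<open>x $ i\<close> is a gap of \<open>K\<close> and its environment there switches to the other
  class. A lower bound on that class thus excludes an improvement in the environment.\<close>

lemma env_change_subset:
  assumes "muP x < muK x"
  shows "cart_prod (env (F(i := K)) x) \<subseteq> cart_prod ((env F x)(i := Q))"
proof -
  have "dist1 P (x $ i) < dist1 K (x $ i)"
    using assms classes_nonempty[OF PQ] by (simp add: mu_pt_upd)
  from environment1_class_gap[OF PQ this] show ?thesis
    unfolding env_fun_upd by (intro cart_prod_mono) auto
qed

text \<open>Both \<open>x\<close> and \<open>z\<close> lose by passing from their classes to
  \<open>K\<close>, so their coordinates at \<open>i\<close> are gaps of opposite parity. Counting
  \<open>z $ i\<close> as a member makes \<open>z\<close> better than \<open>x\<close>, and in
  coordinate \<open>i\<close> the walk from \<open>x\<close> to \<open>z\<close> can exit only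
  through the escape facing \<open>z $ i\<close>.\<close>

lemma crossing_improvement:
  assumes x: "x \<in> J" "muP x < muK x" and z: "z \<in> J" "muQ z < muK z" "muQ z < muK x"
  obtains w where "w \<in> J" "mu_pt w (cart_prod (env (F(i := K)) x)) < muK x"
  | w k v where "w \<in> J" "k \<noteq> i" "v \<in> escape_values (F k) (x $ k)"
      "mu_pt w (cart_prod ((env (F(i := K)) x)(k := {v}))) < muK x"
  | w where "w \<in> J" "escape_towards K (x $ i) (z $ i) \<in> K"
      "mu_pt w (cart_prod ((env (F(i := K)) x)(i := {escape_towards K (x $ i) (z $ i)}))) < muK x"
proof -
  let ?a = "x $ i" and ?b = "z $ i"
  let ?v = "escape_towards K ?a ?b"
  note ne = classes_nonempty[OF PQ] and K = classes_sponge1(1)[OF PQ]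
  have "dist1 P ?a < dist1 K ?a" using x(2) ne by (simp add: mu_pt_upd)
  note a = class_gap[OF PQ this]
  have "dist1 Q ?b < dist1 K ?b" using z(2) ne by (simp add: mu_pt_upd)
  note b = class_gap[OF complementary_classes_sym[OF PQ] this]
  have "odd (?b - ?a)" using classes_odd[OF PQ a(1) b(1)] by simp
  from crossing[OF K this a(2) b(2) a(3,4) b(3,4)] obtain R where
    R: "?a \<in> R" "?b \<notin> R" "R \<subseteq> same_ends K ?a" "?v \<in> escape_values K ?a" "?v \<noteq> ?b"
      "descent ((dist1 K)(?b := 0)) R {?v} ?b" .
  define d where "d = (\<lambda>k. dist1 (F k))(i := (dist1 K)(?b := 0))"
  define R' where "R' = (\<lambda>k. same_ends (F k) (x $ k))(i := R)"
  define X where "X = (\<lambda>k. escape_values (F k) (x $ k))(i := {?v})"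
  have vK: "?v \<in> K" using R(4) by (simp add: escape_values_def)
  have "(\<Sum>k\<in>UNIV. d k (z $ k)) = (\<Sum>k\<in>UNIV - {i}. dist1 (F k) (z $ k))"
    by (subst sum.remove[of UNIV i]) (auto simp: d_def intro: sum.cong)
  also have "\<dots> \<le> muQ z" using ne by (simp add: mu_pt_upd)
  finally have lt: "(\<Sum>k\<in>UNIV. d k (z $ k)) < muK x" using z(3) by simp
  have desc: "descent (d k) (R' k) (X k) (z $ k)" for k
    using R(6) descent_dist1[OF F] by (simp add: d_def R'_def X_def)
  have R': "x $ k \<in> R' k" "R' k \<subseteq> same_ends ((F(i := K)) k) (x $ k)" for k
    using R(1,3) by (simp_all add: R'_def)
  have X: "X k \<subseteq> (F(i := K)) k" for k using vK by (auto simp: X_def escape_values_def)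
  have d: "\<forall>t\<in>R' k \<union> X k. d k t = dist1 ((F(i := K)) k) t" for k
    using R(2,5) by (auto simp: d_def R'_def X_def split: if_splits)
  from improvement_in_env_or_escape[where F = "F(i := K)" and d = d and R = R' and X = X,
      OF J x(1) z(1) finite_sponge1_upd[OF K] desc R' X d lt]
  show thesis
  proof cases
    case (1 w)
    then show thesis by (rule that(1))
  next
    case (2 w k v)
    show thesis
    proof (cases "k = i")
      case True
      with 2 vK that(3)[of w] show thesis by (simp add: X_def)
    next
      case False
      with 2 that(2)[of w k v] show thesis by (simp add: X_def)
    qed
  qed
qed

end

section \<open>Query procedures\<close>

primrec bind :: "('q, 'a, 'r) procedure \<Rightarrow> ('r \<Rightarrow> ('q, 'a, 's) procedure) \<Rightarrow> ('q, 'a, 's) procedure" where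
  "bind (Return r) f = f r"
| "bind (Ask q k) f = Ask q (\<lambda>a. bind (k a) f)"

lemma run_bind [simp]: "run ans (bind p f) = run ans (f (run ans p))"
  by (induction p) auto

lemma queries_bind [simp]: "queries ans (bind p f) = queries ans p @ queries ans (f (run ans p))"
  by (induction p) auto

primrec ask_list :: "'q list \<Rightarrow> ('q, 'a, 'a list) procedure" where
  "ask_list [] = Return []"
| "ask_list (q # qs) = Ask q (\<lambda>a. bind (ask_list qs) (\<lambda>as. Return (a # as)))"

lemma run_ask_list [simp]: "run ans (ask_list qs) = map ans qs"
  by (induction qs) auto

lemma queries_ask_list [simp]: "queries ans (ask_list qs) = qs"
  by (induction qs) auto

text \<open>The distances in the answers refer to the queried sets, not to \<open>H\<close>, and are
  dropped; \<open>H\<close> is explicit, so distances from it cost no query.\<close>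

definition best_of_answers ::
    "(int ^ 'n) set \<Rightarrow> (int ^ 'n) list \<Rightarrow> (int ^ 'n) set list \<Rightarrow>
      ((int ^ 'n) set, nat \<times> (int ^ 'n), int ^ 'n) procedure" where
  "best_of_answers H xs qs =
     bind (ask_list qs) (\<lambda>as. Return (arg_min_list (\<lambda>y. mu_pt y H) (xs @ map snd as)))"

lemma queries_best_of_answers [simp]: "queries ans (best_of_answers H xs qs) = qs"
  by (simp add: best_of_answers_def)

lemma parity_sponge_nonempty: "parity_sponge P \<Longrightarrow> P \<noteq> {}"
  unfolding parity_sponge_def
  by (metis cart_prod_nonempty finite_sponge1_nonempty spongeE)

lemma deficiency_solverD:
  assumes "deficiency_solver J ans" "parity_sponge P"
  shows "snd (ans P) \<in> J" "fst (ans P) = mu_pt (snd (ans P)) P"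
    "w \<in> J \<Longrightarrow> mu_pt (snd (ans P)) P \<le> mu_pt w P"
  using assms optimal_iff[OF parity_sponge_nonempty[OF assms(2)], of J "snd (ans P)"]
  unfolding deficiency_solver_def optimal_def by auto

text \<open>\<open>v\<close> is the expected optimum: a lower bound attained by a known candidate or
  on some queried subset of \<open>H\<close>. An answer to such a query is at least as near to
  \<open>H\<close> as to the queried set.\<close>

lemma optimal_best_of_answers:
  assumes ans: "deficiency_solver J ans" and H: "H \<noteq> {}"
    and xs: "xs \<noteq> []" "set xs \<subseteq> J" and qs: "\<And>q. q \<in> set qs \<Longrightarrow> parity_sponge q"
    and good: "(\<exists>y\<in>set xs. mu_pt y H \<le> v) \<or> (\<exists>q\<in>set qs. q \<subseteq> H \<and> (\<exists>w\<in>J. mu_pt w q \<le> v))"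
    and v: "\<And>y. y \<in> J \<Longrightarrow> v \<le> mu_pt y H"
  shows "optimal J H (run ans (best_of_answers H xs qs))"
proof -
  let ?ys = "xs @ map snd (map ans qs)"
  let ?b = "arg_min_list (\<lambda>y. mu_pt y H) ?ys"
  have ne: "?ys \<noteq> []" using xs by simp
  have sub: "set ?ys \<subseteq> J" using xs(2) deficiency_solverD(1)[OF ans qs] by auto
  have b: "?b \<in> set ?ys" by (rule arg_min_list_in[OF ne])
  have le: "mu_pt ?b H \<le> mu_pt y H" if "y \<in> set ?ys" for y
    using that f_arg_min_list_f[OF ne, of "\<lambda>y. mu_pt y H"] by (simp add: Min_le)
  have "\<exists>y\<in>set ?ys. mu_pt y H \<le> v"
    using good
  proof
    assume "\<exists>q\<in>set qs. q \<subseteq> H \<and> (\<exists>w\<in>J. mu_pt w q \<le> v)"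
    then obtain q w where q: "q \<in> set qs" "q \<subseteq> H" "w \<in> J" "mu_pt w q \<le> v" by blast
    have "mu_pt (snd (ans q)) H \<le> mu_pt (snd (ans q)) q"
      by (rule mu_pt_antimono[OF q(2) parity_sponge_nonempty[OF qs[OF q(1)]]])
    with deficiency_solverD(3)[OF ans qs[OF q(1)] q(3)] q(4)
    have "mu_pt (snd (ans q)) H \<le> v" by simp
    with q(1) show ?thesis by force
  qed auto
  with le have "mu_pt ?b H \<le> v" by (meson le_trans)
  then have "optimal J H ?b"
    unfolding optimal_iff[OF H] using b sub v by (meson le_trans subsetD)
  then show ?thesis by (simp add: best_of_answers_def)
qed

section \<open>Solving the deficiency problem of a sponge\<close>

definition escapes :: "('n \<Rightarrow> int set) \<Rightarrow> int ^ 'n \<Rightarrow> 'n \<Rightarrow> (int ^ 'n) set list" where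
  "escapes F x k = map (\<lambda>v. cart_prod ((env F x)(k := {v})))
     (filter (\<lambda>v. v \<in> F k) [lower_end (F k) (x $ k) - 1, upper_end (F k) (x $ k) + 1])"

lemma set_escapes: "set (escapes F x k) = (\<lambda>v. cart_prod ((env F x)(k := {v}))) ` escape_values (F k) (x $ k)"
  unfolding escapes_def set_map by (rule image_cong) (auto simp: escape_values_def)

lemma length_concat_escapes: "length (concat (map (escapes F x) ks)) \<le> 2 * length ks"
proof (induction ks)
  case (Cons k ks)
  have "length (escapes F x k) \<le> 2"
    unfolding escapes_def length_map by (rule order.trans[OF length_filter_le]) simp
  with Cons show ?case by simp
qed simp

lemma parity_sponge_env:
  assumes "\<And>k. finite_sponge1 (F k)"
  shows "parity_sponge (cart_prod (env F x))"
    and "finite_sponge1 A \<Longrightarrow> same_parity A \<Longrightarrow> parity_sponge (cart_prod ((env F x)(i := A)))"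
proof -
  have e: "finite_sponge1 (env F x k)" "same_parity (env F x k)" for k
    using assms by (simp_all add: env_def finite_sponge1_environment1 same_parity_environment1)
  show "parity_sponge (cart_prod (env F x))" by (rule parity_sponge_cart_prod) (rule e)+
  show "parity_sponge (cart_prod ((env F x)(i := A)))" if "finite_sponge1 A" "same_parity A"
    using e that by (intro parity_sponge_cart_prod) auto
qed

lemma finite_sponge1_singleton: "finite_sponge1 {a}" "same_parity {a}"
  by (auto simp: finite_sponge1_def sponge1_def same_parity_def)

lemma parity_sponge_env_singleton:
  assumes "\<And>k. finite_sponge1 (F k)"
  shows "parity_sponge (cart_prod ((env F x)(i := {a})))"
  by (rule parity_sponge_env(2)[of F, OF assms finite_sponge1_singleton])

lemma parity_sponge_escapes:
  assumes "\<And>k. finite_sponge1 (F k)" "q \<in> set (escapes F x k)"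
  shows "parity_sponge q"
  using assms(2) parity_sponge_env_singleton[of F, OF assms(1)] unfolding set_escapes by blast

text \<open>As \<open>x\<close> is within one of the lower bound \<open>v\<close>, every improvement
  attains \<open>v\<close>. The last assumption excludes the environment, and coordinates outside
  \<open>ks\<close> have no escapes.\<close>

lemma escapes_suffice:
  assumes J: "jump_system J" and ans: "deficiency_solver J ans"
    and G: "\<And>k. finite_sponge1 (G k)" "\<And>k. k \<notin> set ks \<Longrightarrow> same_parity (G k)"
    and x: "x \<in> set xs" "set xs \<subseteq> J" "mu_pt x (cart_prod G) \<le> v + 1"
    and v: "\<And>y. y \<in> J \<Longrightarrow> v \<le> mu_pt y (cart_prod G)"
    and env: "\<And>w. w \<in> J \<Longrightarrow> v < mu_pt x (cart_prod G) \<Longrightarrow> v < mu_pt w (cart_prod (env G x))"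
  shows "optimal J (cart_prod G) (run ans (best_of_answers (cart_prod G) xs (concat (map (escapes G x) ks))))"
proof -
  let ?qs = "concat (map (escapes G x) ks)"
  have ne: "cart_prod G \<noteq> {}" by (rule cart_prod_nonempty[OF finite_sponge1_nonempty[OF G(1)]])
  have xs: "xs \<noteq> []" "x \<in> J" using x by auto
  have par: "parity_sponge q" if "q \<in> set ?qs" for q
    using that parity_sponge_escapes[of G, OF G(1)] by auto
  note best = optimal_best_of_answers[OF ans ne xs(1) x(2) par]
  show ?thesis
  proof (cases "\<exists>y\<in>J. mu_pt y (cart_prod G) < mu_pt x (cart_prod G)")
    case False
    then have "mu_pt x (cart_prod G) \<le> mu_pt y (cart_prod G)" if "y \<in> J" for y
      using that by (meson not_less)
    with x(1) show ?thesis by (intro best[where v = "mu_pt x (cart_prod G)"]) auto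
  next
    case True
    then obtain y where y: "y \<in> J" "mu_pt y (cart_prod G) < mu_pt x (cart_prod G)" by blast
    with v[OF y(1)] x(3) have mux: "mu_pt x (cart_prod G) = v + 1" by simp
    from not_optimal_improvement[where F = G, OF J xs(2) y(1) G(1) y(2)]
    obtain w k a where w: "w \<in> J" "a \<in> escape_values (G k) (x $ k)"
      "mu_pt w (cart_prod ((env G x)(k := {a}))) \<le> v"
    proof cases
      case (1 w)
      with env[OF 1(1)] mux show thesis by simp
    next
      case (2 w k a)
      with mux show thesis by (intro that) auto
    qed
    have "k \<in> set ks" using escape_values_same_parity[OF G(1) G(2)] w(2) by blast
    then have "cart_prod ((env G x)(k := {a})) \<in> set ?qs" using w(2) by (auto simp: set_escapes)
    moreover have "cart_prod ((env G x)(k := {a})) \<subseteq> cart_prod G"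
      using w(2) by (intro env_fun_upd_subset) (auto simp: escape_values_def)
    ultimately show ?thesis using w(1,3) v by (intro best[where v = v]) blast+
  qed
qed

text \<open>
  Here \<open>x\<close> is optimal for \<open>F\<close>, and \<open>F i\<close> and \<open>Q\<close> are the two parity classes for \<open>K\<close>. The first query
  tells whether \<open>Q\<close> is the better one. If the classes turn out to be equally good, \<open>crossing_improvement\<close>
  makes one escape in coordinate \<open>i\<close> superfluous, and otherwise the environment is superfluous.
\<close>

definition stage :: "('n \<Rightarrow> int set) \<Rightarrow> 'n \<Rightarrow> int set \<Rightarrow> int set \<Rightarrow> 'n list \<Rightarrow> int ^ 'n \<Rightarrow>
    ((int ^ 'n) set, nat \<times> (int ^ 'n), int ^ 'n) procedure" where
  "stage F i K Q ks x =
     Ask (cart_prod ((env F x)(i := Q))) (\<lambda>(\<phi>, z).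
       best_of_answers (cart_prod (F(i := K))) [x, z]
         (if \<phi> = mu_pt x (cart_prod F) then
            cart_prod (env (F(i := K)) x) # concat (map (escapes (F(i := K)) x) ks) @
            [cart_prod ((env (F(i := K)) x)(i := {escape_towards K (x $ i) (z $ i)}))]
          else
            concat (map (escapes (F(i := K)) (if \<phi> < mu_pt x (cart_prod F) then z else x)) (i # ks))))"

text \<open>After the comparison query, either branch adds at most \<open>2 * length ks + 2\<close>:
  environment, escapes along \<open>ks\<close> and one facing escape, or the escapes of
  \<open>length ks + 1\<close> coordinates.\<close>

lemma queries_stage:
  assumes F: "\<And>k. finite_sponge1 (F k)" and PQ: "complementary_classes K (F i) Q"
  shows "\<forall>q\<in>set (queries ans (stage F i K Q ks x)). parity_sponge q"
    and "length (queries ans (stage F i K Q ks x)) \<le> 2 * length ks + 3"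
proof -
  have G: "finite_sponge1 ((F(i := K)) k)" for k using F classes_sponge1(1)[OF PQ] by simp
  note G' = parity_sponge_escapes[of "F(i := K)", OF G] parity_sponge_env(1)[of "F(i := K)", OF G]
    parity_sponge_env_singleton[of "F(i := K)", OF G]
  have "parity_sponge (cart_prod ((env F x)(i := Q)))"
    by (rule parity_sponge_env(2)[of F, OF F classes_sponge1(3,5)[OF PQ]])
  with G' show "\<forall>q\<in>set (queries ans (stage F i K Q ks x)). parity_sponge q"
    by (auto simp: stage_def case_prod_unfold split: if_splits)
  have "length (concat (map (escapes (F(i := K)) y) (i # ks))) \<le> 2 * length (i # ks)"
      "length (concat (map (escapes (F(i := K)) y) ks)) \<le> 2 * length ks" for y
    by (rule length_concat_escapes)+
  then show "length (queries ans (stage F i K Q ks x)) \<le> 2 * length ks + 3"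
    by (simp add: stage_def case_prod_unfold del: map_map concat.simps list.map)
qed

lemma optimal_stage:
  fixes x :: "int ^ 'n"
  assumes J: "jump_system J" and ans: "deficiency_solver J ans"
    and Fs: "\<And>k. finite_sponge1 (F k)" "\<And>k. k \<notin> set ks \<Longrightarrow> same_parity (F k)"
    and PQ: "complementary_classes K (F i) Q" and x: "optimal J (cart_prod F) x"
  shows "optimal J (cart_prod (F(i := K))) (run ans (stage F i K Q ks x))"
proof -
  interpret class_change J F i K "F i" Q using J Fs(1) PQ by unfold_locales
  interpret swap: class_change J F i K Q "F i"
    using J Fs(1) complementary_classes_sym[OF PQ] by unfold_locales
  let ?G = "F(i := K)" and ?q = "cart_prod ((env F x)(i := Q))"
  define v where "v = mu_pt x (cart_prod F)"
  define \<phi> where "\<phi> = fst (ans ?q)"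
  define z where "z = snd (ans ?q)"
  have G: "finite_sponge1 (?G k)" for k using finite_sponge1_upd[OF classes_sponge1(1)[OF PQ]] .
  have par: "same_parity (?G k)" if "k \<notin> set (i # ks)" for k using that Fs(2) by simp
  have xJ: "x \<in> J" and vP: "\<And>y. y \<in> J \<Longrightarrow> v \<le> muP y" "muP x = v"
    using x unfolding optimal_iff[OF cart_prod_nonempty[OF F_nonempty]] by (simp_all add: v_def)
  have q: "parity_sponge ?q"
    by (rule parity_sponge_env(2)[of F, OF Fs(1) classes_sponge1(3,5)[OF PQ]])
  note z = deficiency_solverD[OF ans q, folded z_def \<phi>_def]
  have zQ: "muQ z \<le> \<phi>"
    unfolding z(2) by (rule mu_pt_antimono[OF env_upd_subset env_upd_nonempty])
      (use classes_nonempty[OF PQ] in auto)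
  have run: "run ans (stage F i K Q ks x) = run ans (best_of_answers (cart_prod ?G) [x, z]
         (if \<phi> = v then
            cart_prod (env ?G x) # concat (map (escapes ?G x) ks) @
            [cart_prod ((env ?G x)(i := {escape_towards K (x $ i) (z $ i)}))]
          else concat (map (escapes ?G (if \<phi> < v then z else x)) (i # ks))))"
    by (simp only: stage_def run.simps case_prod_unfold v_def \<phi>_def z_def)
  have xz: "set [x, z] \<subseteq> J" using xJ z(1) by simp
  \<comment> \<open>The comparison on the environment decides for all of \<open>J\<close>: a value
    below \<open>v\<close> for \<open>Q\<close> anywhere would push \<open>\<phi>\<close> below
    \<open>v\<close>.\<close>
  have vQ: "v \<le> muQ y" if "v \<le> \<phi>" "y \<in> J" for y
  proof (rule ccontr)
    assume "\<not> v \<le> muQ y"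
    then have "muQ y < muP x" using vP(2) by simp
    from other_class_better_on_env[OF xJ _ that(2) this] vP obtain w
      where "w \<in> J" "mu_pt w ?q < muP x" by auto
    with z(2) z(3)[of w] that(1) vP(2) show False by simp
  qed
  consider "\<phi> < v" | "v < \<phi>" | "\<phi> = v" by linarith
  then show ?thesis
  proof cases
    case 1
    \<comment> \<open>By symmetry \<open>Q\<close> beats \<open>F i\<close> by at most one, so
      \<open>z\<close> attains the optimum \<open>v - 1\<close> for \<open>Q\<close>.\<close>
    have vQ': "v - 1 \<le> muQ y" if "y \<in> J" for y using swap.muQ_le[of y] vP(1)[OF that] by simp
    have zv: "muQ z = v - 1" using vQ'[OF z(1)] zQ 1 by simp
    have "optimal J (cart_prod ?G) (run ans (best_of_answers (cart_prod ?G) [x, z]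
      (concat (map (escapes ?G z) (i # ks)))))"
    proof (rule escapes_suffice[where G = ?G and v = "v - 1", OF J ans G par _ xz])
      show "z \<in> set [x, z]" by simp
      show "muK z \<le> v - 1 + 1" using swap.muK_le[of z] zv by simp
      show "v - 1 \<le> muK y" if "y \<in> J" for y using muK_ge vP(1)[OF that] vQ'[OF that] by simp
      \<comment> \<open>Unless \<open>z\<close> attains \<open>v - 1\<close> for \<open>K\<close>
        too, its environment in \<open>K\<close> lies in the worse class \<open>F i\<close>, where
        no distance is below \<open>v\<close>.\<close>
      fix w assume w: "w \<in> J" "v - 1 < muK z"
      then have "cart_prod (env ?G z) \<subseteq> cart_prod ((env F z)(i := F i))"
        using zv by (intro swap.env_change_subset) simp
      also have "\<dots> \<subseteq> cart_prod (F(i := F i))" by (rule env_upd_subset) simp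
      finally have "muP w \<le> mu_pt w (cart_prod (env ?G z))"
        by (rule mu_pt_antimono) (rule cart_prod_env_nonempty(1)[of ?G, OF G])
      with vP(1)[OF w(1)] 1 show "v - 1 < mu_pt w (cart_prod (env ?G z))" by simp
    qed
    then show ?thesis unfolding run using 1 by simp
  next
    case 2
    have "optimal J (cart_prod ?G) (run ans (best_of_answers (cart_prod ?G) [x, z]
      (concat (map (escapes ?G x) (i # ks)))))"
    proof (rule escapes_suffice[where G = ?G and v = v, OF J ans G par _ xz])
      show "x \<in> set [x, z]" by simp
      show "muK x \<le> v + 1" using muK_le[of x] vP(2) by simp
      show "v \<le> muK y" if "y \<in> J" for y using muK_ge vP(1)[OF that] vQ[OF _ that] 2 by simp
      \<comment> \<open>Here the environment of \<open>x\<close> in \<open>K\<close> is part of the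
        set of the comparison query, whose optimum \<open>\<phi>\<close> exceeds
        \<open>v\<close>.\<close>
      fix w assume w: "w \<in> J" "v < muK x"
      then have "cart_prod (env ?G x) \<subseteq> ?q" using vP(2) by (intro env_change_subset) simp
      then have "mu_pt w ?q \<le> mu_pt w (cart_prod (env ?G x))"
        by (rule mu_pt_antimono) (rule cart_prod_env_nonempty(1)[of ?G, OF G])
      with 2 z(2) z(3)[OF w(1)] show "v < mu_pt w (cart_prod (env ?G x))" by simp
    qed
    then show ?thesis unfolding run using 2 by simp
  next
    case 3
    let ?e = "cart_prod ((env ?G x)(i := {escape_towards K (x $ i) (z $ i)}))"
    let ?qs = "cart_prod (env ?G x) # concat (map (escapes ?G x) ks) @ [?e]"
    have vK: "v \<le> muK y" if "y \<in> J" for y using muK_ge vP(1)[OF that] vQ[OF _ that] 3 by simp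
    have neG: "cart_prod ?G \<noteq> {}" by (rule cart_prod_nonempty[OF finite_sponge1_nonempty[OF G]])
    have parq: "parity_sponge q" if "q \<in> set ?qs" for q
      using that parity_sponge_escapes[of ?G, OF G] parity_sponge_env(1)[of ?G, OF G]
        parity_sponge_env_singleton[of ?G, OF G] by auto
    have "(\<exists>y\<in>set [x, z]. muK y \<le> v) \<or> (\<exists>q\<in>set ?qs. q \<subseteq> cart_prod ?G \<and> (\<exists>w\<in>J. mu_pt w q \<le> v))"
    proof (cases "muK x \<le> v \<or> muK z \<le> v")
      case False
      \<comment> \<open>Both class optima equal \<open>v\<close>, and both witnesses lose by passing
        to \<open>K\<close>: this is the situation of a crossing.\<close>
      then have lt: "muP x < muK x" "muQ z < muK z" "muQ z < muK x" using vP(2) zQ 3 by auto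
      have "muK x = v + 1" using muK_le[of x] vP(2) lt(1) by simp
      from crossing_improvement[OF xJ lt(1) z(1) lt(2,3), unfolded this]
      have "\<exists>q\<in>set ?qs. q \<subseteq> cart_prod ?G \<and> (\<exists>w\<in>J. mu_pt w q < v + 1)"
      proof cases
        case (1 w)
        then show ?thesis using cart_prod_env_subset[of ?G x] by auto
      next
        case (2 w k a)
        then have a: "a \<in> escape_values (?G k) (x $ k)" by simp
        then have "k \<in> set ks"
          using escape_values_same_parity[OF G par, of k] 2(2) by auto
        moreover have "cart_prod ((env ?G x)(k := {a})) \<in> set (escapes ?G x k)"
          using a unfolding set_escapes by blast
        moreover have "cart_prod ((env ?G x)(k := {a})) \<subseteq> cart_prod ?G"
          using a by (intro env_fun_upd_subset) (auto simp: escape_values_def)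
        ultimately show ?thesis using 2(1,4) by auto
      next
        case (3 w)
        have "?e \<subseteq> cart_prod ?G" using 3(2) by (intro env_fun_upd_subset) simp
        with 3 show ?thesis by auto
      qed
      then show ?thesis by (auto simp: less_Suc_eq_le)
    qed auto
    from optimal_best_of_answers[OF ans neG _ xz parq this vK] show ?thesis
      unfolding run using 3 by simp
  qed
qed

section \<open>Replacing the classes one coordinate at a time\<close>

definition mixed_factors :: "('n \<Rightarrow> int set) \<Rightarrow> 'n list \<Rightarrow> 'n \<Rightarrow> int set" where
  "mixed_factors A ks k = (if k \<in> set ks then A k else even_class (A k))"

text \<open>The head of the list is the coordinate replaced last; its stage receives the tail as the
  coordinates that already hold their true factor.\<close>

primrec solve :: "('n \<Rightarrow> int set) \<Rightarrow> 'n list \<Rightarrow>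
    ((int ^ 'n) set, nat \<times> (int ^ 'n), int ^ 'n) procedure" where
  "solve A [] = Ask (cart_prod (mixed_factors A [])) (\<lambda>a. Return (snd a))"
| "solve A (i # ks) =
     bind (solve A ks) (stage (mixed_factors A ks) i (A i) (odd_class (A i)) ks)"

text \<open>The count telescopes: \<open>2 * k + 3\<close> is the difference between the squares of
  \<open>k + 2\<close> and \<open>k + 1\<close>, and the initial query starts the sum at 1.\<close>

lemma solve_correct:
  fixes A :: "'n::finite \<Rightarrow> int set"
  assumes J: "jump_system J" and ans: "deficiency_solver J ans" and A: "\<And>k. finite_sponge1 (A k)"
    and "distinct ks" "\<And>k. k \<in> set ks \<Longrightarrow> even_class (A k) \<noteq> A k"
  shows "optimal J (cart_prod (mixed_factors A ks)) (run ans (solve A ks)) \<and>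
    (\<forall>q\<in>set (queries ans (solve A ks)). parity_sponge q) \<and>
    length (queries ans (solve A ks)) \<le> (length ks + 1)\<^sup>2"
  using assms(4,5)
proof (induction ks)
  case Nil
  have "parity_sponge (cart_prod (mixed_factors A []))"
    by (rule parity_sponge_cart_prod) (simp_all add: mixed_factors_def finite_sponge1_even_class[OF A])
  then show ?case using ans by (simp add: deficiency_solver_def)
next
  case (Cons i ks)
  let ?F = "mixed_factors A ks"
  have F: "finite_sponge1 (?F k)" "k \<notin> set ks \<Longrightarrow> same_parity (?F k)" for k
    using A finite_sponge1_even_class[OF A] by (simp_all add: mixed_factors_def)
  have Fi: "?F i = even_class (A i)" using Cons.prems(1) by (simp add: mixed_factors_def)
  have PQ: "complementary_classes (A i) (?F i) (odd_class (A i))"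
    unfolding Fi by (rule complementary_even_odd_class[OF A]) (simp add: Cons.prems(2))
  have upd: "?F(i := A i) = mixed_factors A (i # ks)"
    by (rule ext) (simp add: mixed_factors_def)
  have IH: "optimal J (cart_prod ?F) (run ans (solve A ks))"
    "\<forall>q\<in>set (queries ans (solve A ks)). parity_sponge q"
    "length (queries ans (solve A ks)) \<le> (length ks + 1)\<^sup>2"
    using Cons by auto
  have "(length (i # ks) + 1)\<^sup>2 = (length ks + 1)\<^sup>2 + (2 * length ks + 3)"
    by (simp add: power2_eq_square)
  with IH queries_stage[of ?F, OF F(1) PQ]
    optimal_stage[where F = ?F, OF J ans F PQ IH(1), unfolded upd]
  show ?case by (auto intro: add_mono)
qed

text \<open>
  In dimension one the lower escape from an answer to the first query is at least as close to the
  leftmost section as that answer, so it cannot be an improvement.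
\<close>

lemma dist1_ge_2:
  assumes K: "finite_sponge1 K" and t: "\<not> dist1 K t \<le> 1"
  shows "\<exists>c::int. (c = 1 \<or> c = - 1) \<and> (\<forall>h\<in>K. 2 \<le> c * (h - t))"
proof -
  have far: "2 \<le> \<bar>h - t\<bar>" if "h \<in> K" for h using dist1_le[OF that, of t] t by linarith
  \<comment> \<open>With members on both sides of the missing \<open>t\<close>, the gap condition
    would make \<open>t + 1\<close> a member at distance one.\<close>
  have up: "t + 2 \<le> g" if "h \<in> K" "t + 2 \<le> h" "g \<in> K" for g h
  proof (rule ccontr)
    assume "\<not> t + 2 \<le> g"
    with far[OF that(3)] have "g < t" by linarith
    moreover have "t \<notin> K" using far by force
    ultimately have "t + 1 \<in> K" using finite_sponge1_gap(2)[OF K that(3,1)] that(2) by simp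
    from far[OF this] show False by simp
  qed
  show ?thesis
  proof (cases "\<exists>h\<in>K. t + 2 \<le> h")
    case True
    then have "2 \<le> 1 * (g - t)" if "g \<in> K" for g using up[OF _ _ that] by force
    then show ?thesis by blast
  next
    case False
    then have "2 \<le> - 1 * (g - t)" if "g \<in> K" for g using far[OF that] that by force
    then show ?thesis by blast
  qed
qed

text \<open>Three queries are all that the bound allows for \<open>n = 1\<close>: the leftmost
  section, the environment of its answer and one escape. No comparison with another class takes
  place.\<close>

definition solve_line :: "('n \<Rightarrow> int set) \<Rightarrow> 'n \<Rightarrow>
    ((int ^ 'n) set, nat \<times> (int ^ 'n), int ^ 'n) procedure" where
  "solve_line A i = Ask (cart_prod (\<lambda>k. environment1 (A k) (Min (A k)))) (\<lambda>(_, x).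
     best_of_answers (cart_prod A) [x]
       [cart_prod (env A x), cart_prod ((env A x)(i := {upper_end (A i) (x $ i) + 1}))])"

text \<open>If the lower escape value \<open>e\<close> exists, the leftmost section ends at some
  \<open>q\<close> below \<open>t\<close>, so \<open>t\<close> is at least \<open>t - q\<close> away
  from it. A \<open>y\<close> nearer to \<open>e\<close> than \<open>t\<close> is to
  \<open>K\<close> would be closer to that section, either at \<open>e\<close> itself or by a detour
  over \<open>e\<close> to \<open>q\<close>.\<close>

lemma lower_escape_not_better:
  assumes K: "finite_sponge1 K" and e: "lower_end K t - 1 \<in> K"
    and t: "dist1 (environment1 K (Min K)) t \<le> dist1 (environment1 K (Min K)) y"
  shows "dist1 K t \<le> nat \<bar>y - (lower_end K t - 1)\<bar>"
proof (rule ccontr)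
  assume "\<not> dist1 K t \<le> nat \<bar>y - (lower_end K t - 1)\<bar>"
  define e where "e = lower_end K t - 1"
  let ?m = "Min K"
  define E where "E = environment1 K ?m"
  define q where "q = upper_end K ?m"
  have fin: "finite K" "K \<noteq> {}" using K finite_sponge1_nonempty by (auto simp: finite_sponge1_def)
  have eK: "e \<in> K" using assms(2) by (simp add: e_def)
  have lt: "\<bar>y - e\<bar> < int (dist1 K t)"
    using \<open>\<not> dist1 K t \<le> nat \<bar>y - (lower_end K t - 1)\<bar>\<close> unfolding e_def by linarith
  have m: "?m \<in> K" "?m \<le> e" using fin eK by auto
  have "{?m..?m} = {?m}" by simp
  then have l: "lower_end K ?m = ?m"
    using lower_end_le[OF K m(1), of ?m] lower_end_props(1)[OF K, of ?m] fin
    by (intro antisym) (auto intro: same_parity_subset_singleton)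
  have qK: "q \<in> K" by (simp add: q_def upper_end_props[OF K])
  have E: "E = K \<inter> {?m..q}" by (simp add: E_def environment1_def q_def l)
  have parE: "same_parity E" by (simp add: E_def same_parity_environment1[OF K])
  have et: "e < t"
  proof (rule ccontr)
    assume "\<not> e < t"
    then have "K \<inter> {e..t} \<subseteq> {e}" by auto
    from lower_end_le[OF K eK same_parity_subset_singleton[OF this]] show False by (simp add: e_def)
  qed
  have qt: "q < t"
  proof (rule ccontr)
    assume "\<not> q < t"
    then have "K \<inter> {?m..t} \<subseteq> E" by (auto simp: E)
    from lower_end_le[OF K m(1) same_parity_subset[OF parE this]] m(2) show False by (simp add: e_def)
  qed
  have qE: "q \<in> E" using qK fin by (simp add: E)
  obtain h where h: "h \<in> E" "dist1 E t = nat \<bar>t - h\<bar>" using dist1_attained[of E t] qE by blast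
  have "h \<le> q" using h(1) by (simp add: E)
  with h(2) qt have dt: "t - q \<le> int (dist1 E t)" by linarith
  have dK: "int (dist1 K t) \<le> t - q" "int (dist1 K t) \<le> t - e"
    using dist1_le[OF qK, of t] dist1_le[OF eK, of t] qt et by linarith+
  have "int (dist1 E y) < t - q"
  proof (cases "e \<le> q")
    case True
    then have "e \<in> E" using eK m(2) by (simp add: E)
    from dist1_le[OF this, of y] lt dK(1) show ?thesis by linarith
  next
    case False
    with dist1_le[OF qE, of y] lt dK show ?thesis by linarith
  qed
  with dt t show False by (simp add: E_def)
qed

lemma solve_line_correct:
  fixes A :: "'n::finite \<Rightarrow> int set" and i :: 'n
  assumes J: "jump_system J" and ans: "deficiency_solver J ans" and A: "\<And>k. finite_sponge1 (A k)"
    and n: "(UNIV :: 'n set) = {i}"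
  shows "optimal J (cart_prod A) (run ans (solve_line A i))"
    and "\<forall>q\<in>set (queries ans (solve_line A i)). parity_sponge q"
    and "length (queries ans (solve_line A i)) = 3"
proof -
  let ?E = "\<lambda>k. environment1 (A k) (Min (A k))"
  let ?q = "cart_prod ?E"
  let ?x = "snd (ans ?q)"
  let ?u = "upper_end (A i) (?x $ i) + 1"
  let ?qs = "[cart_prod (env A ?x), cart_prod ((env A ?x)(i := {?u}))]"
  have q: "parity_sponge ?q"
    by (rule parity_sponge_cart_prod)
      (simp_all add: finite_sponge1_environment1[OF A] same_parity_environment1[OF A])
  have par: "parity_sponge q" if "q \<in> set ?qs" for q
    using that parity_sponge_env(1)[of A, OF A] parity_sponge_env_singleton[of A, OF A] by auto
  show "\<forall>q\<in>set (queries ans (solve_line A i)). parity_sponge q"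
    using q par by (auto simp: solve_line_def case_prod_unfold)
  show "length (queries ans (solve_line A i)) = 3" by (simp add: solve_line_def case_prod_unfold)
  have ne: "cart_prod A \<noteq> {}" by (rule cart_prod_nonempty[OF finite_sponge1_nonempty[OF A]])
  note x = deficiency_solverD[OF ans q]
  have mu: "mu_pt y (cart_prod F) = dist1 (F i) (y $ i)" if "F i \<noteq> {}" for F and y :: "int ^ 'n"
  proof -
    have "F k \<noteq> {}" for k using that n by (metis UNIV_I singletonD)
    then have "mu_pt y (cart_prod F) = (\<Sum>k\<in>UNIV. dist1 (F k) (y $ k))" by (rule mu_pt_cart_prod)
    then show ?thesis by (simp add: n)
  qed
  have "optimal J (cart_prod A) (run ans (best_of_answers (cart_prod A) [?x] ?qs))"
  proof (cases "\<exists>y\<in>J. mu_pt y (cart_prod A) < mu_pt ?x (cart_prod A)")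
    case False
    then have "mu_pt ?x (cart_prod A) \<le> mu_pt y (cart_prod A)" if "y \<in> J" for y
      using that by (meson not_less)
    with x(1) show ?thesis
      by (intro optimal_best_of_answers[OF ans ne _ _ par, where v = "mu_pt ?x (cart_prod A)"]) auto
  next
    case True
    then obtain y where y: "y \<in> J" "mu_pt y (cart_prod A) < mu_pt ?x (cart_prod A)" by blast
    note neA = finite_sponge1_nonempty[OF A, of i]
    note neE = environment1_nonempty[OF A[of i], of "Min (A i)"]
    have E: "dist1 (?E i) (?x $ i) \<le> dist1 (?E i) (w $ i)" if "w \<in> J" for w
      using x(3)[OF that] neE by (simp add: mu)
    have yx: "dist1 (A i) (y $ i) < dist1 (A i) (?x $ i)" using y(2) neA by (simp add: mu)
    \<comment> \<open>Farther away, all of \<open>A i\<close> would lie on one side of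
      \<open>?x\<close>, and \<open>y\<close> with it; the jump axiom would then give an element of
      \<open>J\<close> one or two steps along, closer to the leftmost section than
      \<open>?x\<close>. With distance one, every improvement is optimal.\<close>
    have "dist1 (A i) (?x $ i) \<le> 1"
    proof (rule ccontr)
      assume "\<not> dist1 (A i) (?x $ i) \<le> 1"
      then obtain c :: int where c: "c = 1 \<or> c = - 1"
        and far: "\<And>h. h \<in> A i \<Longrightarrow> 2 \<le> c * (h - ?x $ i)"
        using dist1_ge_2[OF A[of i], of "?x $ i"] by auto
      obtain g where g: "g \<in> A i" "dist1 (A i) (y $ i) = nat \<bar>y $ i - g\<bar>" using dist1_attained[OF neA] .
      have gx: "dist1 (A i) (?x $ i) \<le> nat \<bar>?x $ i - g\<bar>" using dist1_le g(1) .
      have yc: "0 < c * (y $ i - ?x $ i)"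
      proof -
        have "\<bar>y $ i - g\<bar> < \<bar>?x $ i - g\<bar>" using gx g(2) yx by linarith
        with c far[OF g(1)] show ?thesis by auto
      qed
      obtain h where h: "h \<in> ?E i" "dist1 (?E i) (?x $ i) = nat \<bar>?x $ i - h\<bar>"
        using dist1_attained[OF neE] .
      have hx: "2 \<le> c * (h - ?x $ i)" using far h(1) environment1_subset by blast
      have no: "w $ i \<noteq> ?x $ i + c" "w $ i \<noteq> ?x $ i + 2 * c" if "w \<in> J" for w
      proof -
        have "\<bar>?x $ i - h\<bar> \<le> \<bar>w $ i - h\<bar>"
          using E[OF that] dist1_le[OF h(1), of "w $ i"] h(2) by linarith
        with hx c show "w $ i \<noteq> ?x $ i + c" "w $ i \<noteq> ?x $ i + 2 * c" by auto
      qed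
      define x' where "x' = ?x + axis i (sgn (y $ i - ?x $ i))"
      have ne_i: "?x $ i \<noteq> y $ i" using yc by auto
      have sg: "sgn (y $ i - ?x $ i) = c" using yc c by (auto simp: sgn_if)
      have x'i: "x' $ i = ?x $ i + c" by (simp add: x'_def sg axis_def)
      have "step_towards ?x {y} x'" unfolding step_towards_iff x'_def using ne_i by blast
      moreover have "x' \<notin> J" using no(1) x'i by blast
      ultimately obtain x'' where x'': "step_towards x' {y} x''" "x'' \<in> J"
        using J x(1) y(1) unfolding jump_system_def by blast
      then obtain j where j: "x' $ j \<noteq> y $ j" "x'' = x' + axis j (sgn (y $ j - x' $ j))"
        unfolding step_towards_iff by blast
      have "j = i" using n by (metis UNIV_I singletonD)
      with j x'i yc c have "x'' $ i = ?x $ i + 2 * c" by (auto simp: axis_def sgn_if)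
      with no(2)[OF x''(2)] show False by simp
    qed
    then have mux: "mu_pt ?x (cart_prod A) = 1" using y(2) neA by (simp add: mu)
    from not_optimal_improvement[where F = A, OF J x(1) y(1) A y(2)]
    have "\<exists>q\<in>set ?qs. q \<subseteq> cart_prod A \<and> (\<exists>w\<in>J. mu_pt w q \<le> 0)"
    proof cases
      case (1 w)
      then show ?thesis using cart_prod_env_subset[of A ?x] mux by auto
    next
      case (2 w k a)
      have k: "k = i" using n by (metis UNIV_I singletonD)
      have wa: "mu_pt w (cart_prod ((env A ?x)(i := {a}))) = nat \<bar>w $ i - a\<bar>"
        using dist1_attained[of "{a}" "w $ i"] by (subst mu) auto
      have a: "a \<in> A i" using 2(2) k by (simp add: escape_values_def)
      have "a \<noteq> lower_end (A i) (?x $ i) - 1"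
      proof
        assume al: "a = lower_end (A i) (?x $ i) - 1"
        from lower_escape_not_better[OF A a[unfolded al] E[OF 2(1)]]
        have "dist1 (A i) (?x $ i) \<le> nat \<bar>w $ i - a\<bar>" by (simp add: al)
        with 2(3) wa mux neA k show False by (simp add: mu)
      qed
      then have "a = ?u" using 2(2) k by (auto simp: escape_values_def)
      moreover have "cart_prod ((env A ?x)(i := {a})) \<subseteq> cart_prod A"
        by (rule env_fun_upd_subset) (simp add: a)
      ultimately show ?thesis using 2 k mux by auto
    qed
    then show ?thesis
      using x(1) by (intro optimal_best_of_answers[OF ans ne _ _ par, where v = 0]) auto
  qed
  then show "optimal J (cart_prod A) (run ans (solve_line A i))"
    by (simp add: solve_line_def case_prod_unfold)
qed

theorem theorem3p2:
  fixes H :: "(int ^ 'n) set"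
  assumes "sponge H"
  shows "(\<forall>J. jump_system J \<longrightarrow>
            (\<forall>x\<in>J. \<not> optimal J H x \<longleftrightarrow>
               (\<exists>y\<in>J. mu_pt y (environment H x) < mu_pt x H \<or>
                  (\<exists>i K. (lower_escape H x i = Some K \<or> upper_escape H x i = Some K) \<and>
                     mu_pt y K < mu_pt x H))))
       \<and> (\<exists>A :: ((int ^ 'n) set, nat \<times> (int ^ 'n), int ^ 'n) procedure.
            \<forall>J ans. jump_system J \<and> deficiency_solver J ans \<longrightarrow>
               optimal J H (run ans A) \<and>
               (\<forall>P\<in>set (queries ans A). parity_sponge P) \<and>
               length (queries ans A) \<le> (2 * CARD('n) + 1) * CARD('n))"
proof (intro conjI allI impI ballI)
  fix J :: "(int ^ 'n) set" and x assume "jump_system J" "x \<in> J"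
  then show "\<not> optimal J H x \<longleftrightarrow> (\<exists>y\<in>J. mu_pt y (environment H x) < mu_pt x H \<or>
      (\<exists>i K. (lower_escape H x i = Some K \<or> upper_escape H x i = Some K) \<and> mu_pt y K < mu_pt x H))"
    by (rule not_optimal_iff[OF assms])
next
  obtain A where H: "H = cart_prod A" and A: "\<And>k. finite_sponge1 (A k)"
    using spongeE[OF assms] by metis
  show "\<exists>p :: ((int ^ 'n) set, nat \<times> (int ^ 'n), int ^ 'n) procedure.
      \<forall>J ans. jump_system J \<and> deficiency_solver J ans \<longrightarrow>
        optimal J H (run ans p) \<and> (\<forall>P\<in>set (queries ans p). parity_sponge P) \<and>
        length (queries ans p) \<le> (2 * CARD('n) + 1) * CARD('n)"
  proof (cases "CARD('n) = 1")
    case True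
    then obtain i :: 'n where i: "(UNIV :: 'n set) = {i}" by (rule card_1_singletonE)
    then show ?thesis
      using solve_line_correct[OF _ _ A i] True by (intro exI[of _ "solve_line A i"]) (auto simp: H)
  next
    case False
    \<comment> \<open>A factor equal to its even class is already a parity class and is left
      alone.\<close>
    obtain ks where ks: "set ks = {k. even_class (A k) \<noteq> A k}" "distinct ks"
      using finite_distinct_list[of "{k. even_class (A k) \<noteq> A k}"] by auto
    have mix: "mixed_factors A ks = A" by (rule ext) (auto simp: mixed_factors_def ks(1))
    have len: "length ks \<le> CARD('n)"
      using distinct_card[OF ks(2)] card_mono[of "UNIV :: 'n set" "set ks"] by simp
    have "2 \<le> CARD('n)" using False by (metis One_nat_def Suc_1 Suc_leI card_gt_0_iff finite le_neq_implies_less UNIV_not_empty)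
    \<comment> \<open>The right side minus the left is the square of \<open>n\<close> minus
      \<open>n + 1\<close>; in terms of \<open>m\<close> all its coefficients are positive.\<close>
    then obtain m where m: "CARD('n) = m + 2" by (metis add.commute le_Suc_ex)
    have "(length ks + 1)\<^sup>2 \<le> (CARD('n) + 1)\<^sup>2" using len by (intro power_mono) auto
    also have "\<dots> \<le> (2 * CARD('n) + 1) * CARD('n)" unfolding m by (simp add: power2_eq_square algebra_simps)
    finally have le: "(length ks + 1)\<^sup>2 \<le> (2 * CARD('n) + 1) * CARD('n)" .
    show ?thesis
    proof (intro exI[of _ "solve A ks"] allI impI)
      fix J :: "(int ^ 'n) set" and ans
      assume "jump_system J \<and> deficiency_solver J ans"
      then have *: "jump_system J" "deficiency_solver J ans" by auto
      have "optimal J (cart_prod (mixed_factors A ks)) (run ans (solve A ks)) \<and>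
        (\<forall>q\<in>set (queries ans (solve A ks)). parity_sponge q) \<and>
        length (queries ans (solve A ks)) \<le> (length ks + 1)\<^sup>2"
        by (rule solve_correct[OF * A ks(2)]) (simp add: ks(1))
      with le show "optimal J H (run ans (solve A ks)) \<and>
        (\<forall>P\<in>set (queries ans (solve A ks)). parity_sponge P) \<and>
        length (queries ans (solve A ks)) \<le> (2 * CARD('n) + 1) * CARD('n)"
        unfolding mix H by (meson order.trans)
    qed
  qed
qed

end
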